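(* Let $\Omega\subset\mathbb{R}^2$ be a bounded, piecewise-analytic domain and let $H\subset\mathring{\Omega}$ be an interior real-analytic ($C^\omega$) curve. Let $(\varphi_\lambda)$ be a sequence of $L^2$-normalized Neumann (or Dirichlet) eigenfunctions on $\Omega$ with eigenvalues $\lambda^2$, let $\gamma_H:C^0(\Omega)\to C^0(H)$, $\gamma_H f=f|_H$, be the restriction map, let $H^{\mathbb C}_{\epsilon_0}$ be the complex Grauert tube of radius $\epsilon_0>0$ containing $H$ as its totally real submanifold, and let $(\gamma_H\varphi_\lambda)^{\mathbb C}$ be the holomorphic continuation of $\gamma_H\varphi_\lambda$ to $H^{\mathbb C}_{\epsilon_0}$. Suppose that $H$ satisfies the revised goodness condition: there are $C>0$ and $\lambda_0>0$ such that for all $\lambda\ge\lambda_0$ in the sequence, $$\sup_{z\in H^{\mathbb C}_{\epsilon_0}}\big|(\gamma_H\varphi_\lambda)^{\mathbb C}(z)\big|\ \ge\ e^{-C\lambda}.$$ Then there is a constant $C_{\Omega,H}>0$ such that for all $\lambda\ge\lambda_0$ in the sequence, $$n(\lambda,H)\le C_{\Omega,H}\,\lambda .$$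
   Context: Eigenfunctions: $-\Delta\varphi_\lambda=\lambda^2\varphi_\lambda$ in $\Omega$, with $\partial_\nu\varphi_\lambda=0$ on $\partial\Omega$ (Neumann) or $\varphi_\lambda=0$ on $\partial\Omega$ (Dirichlet). Intersection number: $n(\lambda,H)=\#\{x\in H:\varphi_\lambda(x)=0\}$, the number of points of $H$ lying on the nodal set of $\varphi_\lambda$. Piecewise-analytic domain: $\partial\Omega$ is a Lipschitz boundary (locally the graph of a Lipschitz function) consisting of finitely many real-analytic arcs meeting at finitely many corner points. Grauert tube: identify $\mathbb{R}^2$ with $\mathbb{C}$ where convenient. Let $q=(q_1,q_2):[-\pi,\pi]\to H$ be a real-analytic parametrization with $q'(t)\neq0$ for all $t$ ($2\pi$-periodic if $H$ is closed). For $\epsilon,a>0$ let $S_{\epsilon,a}=\{t\in\mathbb{C}: \mathrm{Re}\,t\in[-a,a],\ \mathrm{Im}\,t\in[-\epsilon,\epsilon]\}$. The number $\epsilon_0>0$ is fixed and small enough, depending only on $(\Omega,H)$, that $q$ extends to a conformal (holomorphic) map $q^{\mathbb C}=(q_1^{\mathbb C},q_2^{\mathbb C})$ on $S_{2\epsilon_0,2\pi}$ and that every function $t\mapsto\varphi_\lambda(q(t))$ extends holomorphically to $S_{2\epsilon_0,2\pi}$. Then $H^{\mathbb C}_{\epsilon_0}:=q^{\mathbb C}(S_{\epsilon_0,\pi})$, and $(\gamma_H\varphi_\lambda)^{\mathbb C}(q^{\mathbb C}(t))$ is the holomorphic extension of $t\mapsto\varphi_\lambda(q(t))$. *)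

theory Defs
  imports "HOL-Complex_Analysis.Complex_Analysis"
begin

definition real_analytic_on :: "(real \<Rightarrow> 'a::real_normed_vector) \<Rightarrow> real set \<Rightarrow> bool" where
  "real_analytic_on f S \<longleftrightarrow>
     (\<forall>x\<in>S. \<exists>a r. 0 < r \<and>
        (\<forall>y\<in>S. \<bar>y - x\<bar> < r \<longrightarrow> (\<lambda>k. (y - x) ^ k *\<^sub>R a k) sums f y))"

(* In the orthonormal frame (e, n) centred at p, the set Omega is, inside a square of half-side r,
   the region strictly above the graph of g; for continuous g the boundary is then the graph. *)
definition boundary_graph ::
  "(real^2) set \<Rightarrow> real^2 \<Rightarrow> real^2 \<Rightarrow> real^2 \<Rightarrow> (real \<Rightarrow> real) \<Rightarrow> real \<Rightarrow> bool" where
  "boundary_graph \<Omega> p e n g r \<longleftrightarrow>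
     0 < r \<and> norm e = 1 \<and> norm n = 1 \<and> e \<bullet> n = 0 \<and>
     (\<forall>s t. \<bar>s\<bar> < r \<and> \<bar>t\<bar> < r \<longrightarrow> (p + s *\<^sub>R e + t *\<^sub>R n \<in> \<Omega> \<longleftrightarrow> g s < t))"

definition lipschitz_boundary :: "(real^2) set \<Rightarrow> bool" where
  "lipschitz_boundary \<Omega> \<longleftrightarrow>
     (\<forall>p\<in>frontier \<Omega>. \<exists>e n g r L. boundary_graph \<Omega> p e n g r \<and> L-lipschitz_on UNIV g)"

definition analytic_arc :: "(real \<Rightarrow> real^2) \<Rightarrow> bool" where
  "analytic_arc \<gamma> \<longleftrightarrow>
     real_analytic_on \<gamma> {0..1} \<and> inj_on \<gamma> {0..1} \<and>
     (\<forall>t\<in>{0..1}. vector_derivative \<gamma> (at t within {0..1}) \<noteq> 0)"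

(* The corner points are among the end points of the arcs. End points at which the boundary
   happens to be smooth are allowed, so a smooth closed boundary curve is cut into arcs. *)
definition piecewise_analytic_boundary :: "(real^2) set \<Rightarrow> bool" where
  "piecewise_analytic_boundary \<Omega> \<longleftrightarrow>
     (\<exists>(N::nat) \<gamma>.
        (\<forall>i<N. analytic_arc (\<gamma> i)) \<and>
        frontier \<Omega> = (\<Union>i<N. \<gamma> i ` {0..1}) \<and>
        (\<forall>i<N. \<forall>j<N. i \<noteq> j \<longrightarrow>
           \<gamma> i ` {0..1} \<inter> \<gamma> j ` {0..1} \<subseteq> {\<gamma> i 0, \<gamma> i 1} \<inter> {\<gamma> j 0, \<gamma> j 1}))"

definition piecewise_analytic_domain :: "(real^2) set \<Rightarrow> bool" where
  "piecewise_analytic_domain \<Omega> \<longleftrightarrow>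
     \<Omega> \<noteq> {} \<and> open \<Omega> \<and> connected \<Omega> \<and> bounded \<Omega> \<and>
     lipschitz_boundary \<Omega> \<and> piecewise_analytic_boundary \<Omega>"

(* The vector nu is the outward unit normal at a boundary point p near which the boundary is
   real-analytic. All boundary points except finitely many corners have such a normal. *)
definition outward_normal :: "(real^2) set \<Rightarrow> real^2 \<Rightarrow> real^2 \<Rightarrow> bool" where
  "outward_normal \<Omega> p \<nu> \<longleftrightarrow>
     p \<in> frontier \<Omega> \<and>
     (\<exists>e g r. boundary_graph \<Omega> p e (- \<nu>) g r \<and> real_analytic_on g {-r<..<r} \<and>
        (g has_real_derivative 0) (at 0))"

definition partial_deriv :: "2 \<Rightarrow> (real^2 \<Rightarrow> real) \<Rightarrow> real^2 \<Rightarrow> real" where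
  "partial_deriv i f x = frechet_derivative f (at x) (axis i 1)"

definition gradient :: "(real^2 \<Rightarrow> real) \<Rightarrow> real^2 \<Rightarrow> real^2" where
  "gradient f x = (\<chi> i. partial_deriv i f x)"

definition laplacian :: "(real^2 \<Rightarrow> real) \<Rightarrow> real^2 \<Rightarrow> real" where
  "laplacian f x = (\<Sum>i\<in>UNIV. partial_deriv i (partial_deriv i f) x)"

definition C1_on :: "(real^2) set \<Rightarrow> (real^2 \<Rightarrow> real) \<Rightarrow> bool" where
  "C1_on U f \<longleftrightarrow> (\<forall>x\<in>U. f differentiable (at x)) \<and> (\<forall>i. continuous_on U (partial_deriv i f))"

definition C2_on :: "(real^2) set \<Rightarrow> (real^2 \<Rightarrow> real) \<Rightarrow> bool" where
  "C2_on U f \<longleftrightarrow> C1_on U f \<and> (\<forall>i. C1_on U (partial_deriv i f))"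

datatype boundary_condition = Dirichlet | Neumann

(* In the Neumann case the gradient extends continuously to the regular boundary points;
   no condition other than continuity of phi is imposed at the corners, where there is no normal. *)
fun satisfies_bc :: "boundary_condition \<Rightarrow> (real^2) set \<Rightarrow> (real^2 \<Rightarrow> real) \<Rightarrow> bool" where
  "satisfies_bc Dirichlet \<Omega> \<phi> \<longleftrightarrow> (\<forall>p\<in>frontier \<Omega>. \<phi> p = 0)"
| "satisfies_bc Neumann \<Omega> \<phi> \<longleftrightarrow>
     (\<forall>p \<nu>. outward_normal \<Omega> p \<nu> \<longrightarrow>
        (\<exists>D. (gradient \<phi> \<longlongrightarrow> D) (at p within \<Omega>) \<and> D \<bullet> \<nu> = 0))"

(* Classical eigenfunctions, continuous up to the boundary; near the corners continuity plays the
   role of the finite-energy condition. *)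
definition normalized_eigenfunction ::
  "boundary_condition \<Rightarrow> (real^2) set \<Rightarrow> real \<Rightarrow> (real^2 \<Rightarrow> real) \<Rightarrow> bool" where
  "normalized_eigenfunction bc \<Omega> lam \<phi> \<longleftrightarrow>
     C2_on \<Omega> \<phi> \<and> continuous_on (closure \<Omega>) \<phi> \<and>
     (\<forall>x\<in>\<Omega>. - laplacian \<phi> x = lam\<^sup>2 * \<phi> x) \<and>
     satisfies_bc bc \<Omega> \<phi> \<and>
     set_lebesgue_integral lborel \<Omega> (\<lambda>x. (\<phi> x)\<^sup>2) = 1"

(* Only the values of q on [-pi, pi] matter for an open arc; a closed curve is the periodic case.
   Self-intersections are not excluded. *)
definition analytic_parametrization :: "(real \<Rightarrow> real^2) \<Rightarrow> (real^2) set \<Rightarrow> bool" where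
  "analytic_parametrization q H \<longleftrightarrow>
     real_analytic_on q {-pi..pi} \<and> q ` {-pi..pi} = H \<and>
     (\<forall>t\<in>{-pi..pi}. vector_derivative q (at t within {-pi..pi}) \<noteq> 0) \<and>
     (q (- pi) = q pi \<longrightarrow> real_analytic_on q UNIV \<and> (\<forall>t. q (t + 2 * pi) = q t))"

definition strip :: "real \<Rightarrow> real \<Rightarrow> complex set" where
  "strip \<epsilon> a = {t. Re t \<in> {-a..a} \<and> Im t \<in> {-\<epsilon>..\<epsilon>}}"

definition curve_extension ::
  "real \<Rightarrow> (real \<Rightarrow> real^2) \<Rightarrow> (complex \<Rightarrow> complex^2) \<Rightarrow> bool" where
  "curve_extension \<epsilon> q qC \<longleftrightarrow>
     (\<forall>i. (\<lambda>t. qC t $ i) holomorphic_on strip (2 * \<epsilon>) (2 * pi)) \<and>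
     (\<forall>t\<in>{-pi..pi}. \<forall>i. qC (of_real t) $ i = of_real (q t $ i))"

definition grauert_tube :: "real \<Rightarrow> (complex \<Rightarrow> complex^2) \<Rightarrow> (complex^2) set" where
  "grauert_tube \<epsilon> qC = qC ` strip \<epsilon> pi"

(* F, a function on the Grauert tube, is the holomorphic continuation of the restriction of f to
   the curve: in the parameter t it is the holomorphic extension h of f o q. *)
definition holomorphic_continuation ::
  "real \<Rightarrow> (real \<Rightarrow> real^2) \<Rightarrow> (complex \<Rightarrow> complex^2) \<Rightarrow> (real^2 \<Rightarrow> real) \<Rightarrow>
   (complex^2 \<Rightarrow> complex) \<Rightarrow> bool" where
  "holomorphic_continuation \<epsilon> q qC f F \<longleftrightarrow>
     (\<exists>h. h holomorphic_on strip (2 * \<epsilon>) (2 * pi) \<and>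
          (\<forall>t\<in>{-pi..pi}. h (of_real t) = of_real (f (q t))) \<and>
          (\<forall>t\<in>strip \<epsilon> pi. F (qC t) = h t))"

definition nodal_points :: "(real^2 \<Rightarrow> real) \<Rightarrow> (real^2) set \<Rightarrow> (real^2) set" where
  "nodal_points \<phi> H = {x \<in> H. \<phi> x = 0}"

(* On the compact strip the continuations are continuous, so the real supremum is a genuine one. *)
definition revised_goodness ::
  "real \<Rightarrow> (complex \<Rightarrow> complex^2) \<Rightarrow> (nat \<Rightarrow> real) \<Rightarrow> (nat \<Rightarrow> complex^2 \<Rightarrow> complex) \<Rightarrow>
   real \<Rightarrow> real \<Rightarrow> bool" where
  "revised_goodness \<epsilon> qC lam F C lam0 \<longleftrightarrow>
     (\<forall>j. lam j \<ge> lam0 \<longrightarrow>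
        (SUP z\<in>grauert_tube \<epsilon> qC. norm (F j z)) \<ge> exp (- (C * lam j)))"

end

theory Submission
  imports Defs "HOL-Probability.Distributions"
begin

text \<open>The nodal points on the curve are the images under \<open>q\<close> of real zeros of the
holomorphic function \<open>h\<close> that extends \<open>\<phi> \<circ> q\<close> from the
parameter interval. A holomorphic function bounded by \<open>M\<close> on a simply connected
domain other than the plane, and at least \<open>m\<close> in modulus at some point of a compact
subset, has at most \<open>c * ln (M / m)\<close> zeros in that subset (lemma
\<open>zero_count\<close>: divide by the Blaschke product of the zeros). The goodness condition
supplies \<open>m = exp (- C * lam)\<close>. What has to be proved is \<open>M = exp (C' *
lam)\<close> on a neighbourhood of the tube parameters, with \<open>C'\<close> independent of the
eigenfunction; then \<open>ln (M / m)\<close> is linear in \<open>lam\<close>.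

The growth estimate comes from the heat kernel. If \<open>\<Delta> \<phi> = - lam\<^sup>2 *
\<phi>\<close> held on the whole plane with \<open>\<phi>\<close> bounded, then \<open>exp
(lam\<^sup>2 * t)\<close> times the convolution of \<open>\<phi>\<close> with the heat kernel at
time \<open>t\<close> would be \<open>\<phi>\<close> itself. Near a point \<open>x0\<close> of the
curve, \<open>\<phi>\<close> is multiplied by a cutoff \<open>\<eta>\<close>. The convolution
remains an entire function of two complex variables, but it now depends on \<open>t\<close>. Its
\<open>t\<close>-derivative (lemma \<open>renormalized_heat_has_vector_derivative\<close>, by
Green's identity) contains only derivatives of \<open>\<eta>\<close>, which live at distance at
least \<open>R / 2\<close> from \<open>x0\<close>. There the complexified kernel is of size
\<open>exp (- c / t)\<close>, as long as the complex point stays near \<open>x0\<close>, so the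
derivative is bounded uniformly in \<open>t\<close>. At \<open>t = 1 / lam\<close> the kernel and
the factor \<open>exp (lam\<^sup>2 * t)\<close> are both \<open>exp (O(lam))\<close>. Hence the
same bound holds for all \<open>0 < t \<le> 1 / lam\<close> (lemma
\<open>renormalized_heat_bound\<close>).

As \<open>t\<close> tends to 0, the convolutions converge at real points to a constant multiple of
\<open>\<phi>\<close>. By Montel's theorem and the identity theorem, \<open>h\<close> inherits the
bound (lemma \<open>holomorphic_extension_bound\<close>). Compactness of the curve makes the
radius \<open>R\<close> and all constants uniform along it, and it also determines how small the
tube radius has to be.\<close>

section \<open>Counting zeros of bounded holomorphic functions\<close>

text \<open>Schwarz's lemma transported by the disc automorphism that moves \<open>a\<close> to the origin.
Scaling by \<open>M + e\<close> instead of \<open>M\<close> makes the bound strict and covers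
\<open>M = 0\<close>.\<close>

lemma bounded_holomorphic_le_Moebius:
  assumes f: "f holomorphic_on ball 0 1" and M: "\<And>z. z \<in> ball 0 1 \<Longrightarrow> norm (f z) \<le> M"
    and a: "a \<in> ball 0 1" "f a = 0" and z: "z \<in> ball 0 1"
  shows "norm (f z) \<le> M * norm (Moebius_function 0 a z)"
proof (rule field_le_epsilon)
  fix e :: real assume e: "0 < e"
  have a1: "norm a < 1" and z1: "norm z < 1" using a z by auto
  have M0: "0 \<le> M" using M[OF z] norm_ge_zero order_trans by blast
  define k where "k = (\<lambda>w. f (Moebius_function 0 (-a) w) / complex_of_real (M + e))"
  have into: "Moebius_function 0 (-a) w \<in> ball 0 1" if "norm w < 1" for w
    using Moebius_function_norm_lt_1[of "-a" w 0] a1 that by simp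
  have "k holomorphic_on ball 0 1"
    unfolding k_def using M0 e
    by (intro holomorphic_intros holomorphic_on_compose_gen[OF Moebius_function_holomorphic f, unfolded o_def])
       (use a1 into in auto)
  moreover have "k 0 = 0" using a by (simp add: k_def Moebius_function_def)
  moreover have "norm (k w) < 1" if "norm w < 1" for w
  proof -
    have "norm (f (Moebius_function 0 (-a) w)) < M + e" using M[OF into[OF that]] e by simp
    moreover have "norm (k w) = norm (f (Moebius_function 0 (-a) w)) / (M + e)"
      using M0 e unfolding k_def norm_divide norm_of_real by simp
    ultimately show ?thesis using M0 e by simp
  qed
  moreover have "norm (Moebius_function 0 a z) < 1" using Moebius_function_norm_lt_1[OF a1 z1] .
  ultimately have "norm (k (Moebius_function 0 a z)) \<le> norm (Moebius_function 0 a z)"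
    by (rule Schwarz_Lemma(1))
  moreover have "Moebius_function 0 (-a) (Moebius_function 0 a z) = z"
    using Moebius_function_compose[of "-a" a z] a1 z1 by simp
  ultimately have "norm (f z) / (M + e) \<le> norm (Moebius_function 0 a z)"
    using M0 e unfolding k_def norm_divide norm_of_real by simp
  then have "norm (f z) \<le> (M + e) * norm (Moebius_function 0 a z)"
    using M0 e by (simp add: divide_simps mult.commute)
  also have "\<dots> \<le> M * norm (Moebius_function 0 a z) + e"
    using Moebius_function_norm_lt_1[OF a1 z1, of 0] e by (simp add: algebra_simps)
  finally show "norm (f z) \<le> M * norm (Moebius_function 0 a z) + e" .
qed

text \<open>Dividing out the Moebius factor of one zero leaves a holomorphic function that still vanishes at
the other zeros and, by the previous lemma, still satisfies the bound \<open>M\<close>. Induction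
over the zeros therefore collects all factors.\<close>

lemma bounded_holomorphic_le_Blaschke_product:
  assumes "finite A" "A \<subseteq> ball 0 1"
    and "f holomorphic_on ball 0 1" "\<And>z. z \<in> ball 0 1 \<Longrightarrow> norm (f z) \<le> M"
    and "\<And>a. a \<in> A \<Longrightarrow> f a = 0" "z \<in> ball 0 1"
  shows "norm (f z) \<le> M * (\<Prod>a\<in>A. norm (Moebius_function 0 a z))"
  using assms
proof (induction A arbitrary: f z rule: finite_induct)
  case empty
  then show ?case by simp
next
  case (insert a A)
  let ?B = "Moebius_function 0 a"
  have a: "a \<in> ball 0 1" "norm a < 1" using insert.prems by auto
  have nz: "1 - cnj a * w \<noteq> 0" if "w \<in> ball 0 1" for w
  proof
    assume "1 - cnj a * w = 0"
    then have "norm a * norm w = 1" by (metis complex_mod_cnj eq_iff_diff_eq_0 norm_mult norm_one)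
    moreover have "norm a * norm w < 1 * 1" using a that by (intro mult_strict_mono) auto
    ultimately show False by simp
  qed
  define k where "k = (\<lambda>w. if w = a then deriv f a else f w / (w - a))"
  have k: "k holomorphic_on ball 0 1"
    by (rule pole_theorem_open_0[of f _ a]) (use insert.prems in \<open>auto simp: k_def\<close>)
  define g where "g = (\<lambda>w. k w * (1 - cnj a * w))"
  have g: "g holomorphic_on ball 0 1" unfolding g_def by (intro holomorphic_intros k)
  have fg: "f w = ?B w * g w" if "w \<in> ball 0 1" for w
    using nz[OF that] insert.prems by (auto simp: g_def k_def Moebius_function_simple)
  have gM_off: "norm (g w) \<le> M" if "w \<in> ball 0 1" "w \<noteq> a" for w
  proof -
    have B0: "?B w \<noteq> 0" using nz[OF that(1)] that(2) by (auto simp: Moebius_function_simple)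
    have "norm (f w) \<le> M * norm (?B w)"
      using bounded_holomorphic_le_Moebius[OF insert.prems(2,3)] a that insert.prems by auto
    then show ?thesis using B0 by (simp add: fg[OF that(1)] norm_mult mult.commute)
  qed
  \<comment> \<open>At the removed zero itself the bound survives by continuity.\<close>
  have gM: "norm (g w) \<le> M" if w: "w \<in> ball 0 1" for w
  proof (cases "w = a")
    case True
    have "isCont g a"
      using g a(1) continuous_on_eq_continuous_at[OF open_ball] holomorphic_on_imp_continuous_on by blast
    then have lim: "((\<lambda>w. norm (g w)) \<longlongrightarrow> norm (g a)) (at a)"
      by (simp add: isCont_def tendsto_norm)
    have "\<forall>\<^sub>F w in at a. w \<in> ball 0 1" using a(1)
      by (meson eventually_at_topological open_ball)
    then have "\<forall>\<^sub>F w in at a. norm (g w) \<le> M"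
      using gM_off by (auto simp: eventually_at_filter elim: eventually_mono)
    then show ?thesis using lim True
      using tendsto_upperbound trivial_limit_at by blast
  qed (use gM_off w in auto)
  have gA: "g b = 0" if "b \<in> A" for b
  proof -
    have "b \<noteq> a" "b \<in> ball 0 1" "f b = 0" using insert that by auto
    then show ?thesis by (simp add: g_def k_def)
  qed
  have "norm (g z) \<le> M * (\<Prod>a\<in>A. norm (Moebius_function 0 a z))"
    by (rule insert.IH) (use insert.prems g gM gA in auto)
  then have "norm (?B z) * norm (g z) \<le> norm (?B z) * (M * (\<Prod>a\<in>A. norm (Moebius_function 0 a z)))"
    by (intro mult_left_mono) auto
  then show ?case using insert.hyps
    by (simp add: fg[OF insert.prems(5)] norm_mult mult_ac)
qed

text \<open>On a compact part of the disc every Moebius factor is at most some \<open>\<theta> < 1\<close>, so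
\<open>N\<close> zeros force \<open>m \<le> M * \<theta> ^ N\<close> at a point where the modulus
is at least \<open>m\<close>.\<close>

lemma zero_count_disc:
  assumes "compact K" "K \<subseteq> ball 0 1"
  obtains c where "c > 0"
    "\<And>A f M m z. \<lbrakk>finite A; A \<subseteq> K; f holomorphic_on ball 0 1; \<And>w. w \<in> ball 0 1 \<Longrightarrow> norm (f w) \<le> M;
        \<And>a. a \<in> A \<Longrightarrow> f a = 0; z \<in> K; 0 < m; m \<le> norm (f z)\<rbrakk> \<Longrightarrow> real (card A) \<le> c * ln (M / m)"
proof (cases "K = {}")
  case True
  show ?thesis by (rule that[of 1]) (use True in auto)
next
  case False
  let ?\<mu> = "\<lambda>p. norm (Moebius_function 0 (fst p) (snd p))"
  have nz: "1 - cnj a * w \<noteq> 0" if "a \<in> K" "w \<in> K" for a w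
  proof
    assume "1 - cnj a * w = 0"
    then have "norm a * norm w = 1" by (metis complex_mod_cnj eq_iff_diff_eq_0 norm_mult norm_one)
    moreover have "norm a * norm w < 1 * 1" using assms that by (intro mult_strict_mono) auto
    ultimately show False by simp
  qed
  have "compact (K \<times> K)" "K \<times> K \<noteq> {}" using assms False by (auto intro: compact_Times)
  moreover have "continuous_on (K \<times> K) ?\<mu>"
    unfolding Moebius_function_simple by (intro continuous_intros) (use nz in auto)
  ultimately obtain p where p: "p \<in> K \<times> K" "\<And>y. y \<in> K \<times> K \<Longrightarrow> ?\<mu> y \<le> ?\<mu> p"
    using continuous_attains_sup[of "K \<times> K" ?\<mu>] by blast
  \<comment> \<open>The midpoint between the maximum and 1 keeps \<open>\<theta>\<close> positive even if all factors vanish.\<close>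
  define \<theta> where "\<theta> = (?\<mu> p + 1) / 2"
  have "fst p \<in> ball 0 1" "snd p \<in> ball 0 1" using p(1) assms(2) unfolding mem_Times_iff by blast+
  then have "?\<mu> p < 1" using Moebius_function_norm_lt_1[of "fst p" "snd p" 0] by auto
  then have \<theta>: "0 < \<theta>" "\<theta> < 1" "?\<mu> p \<le> \<theta>" by (auto simp: \<theta>_def add_nonneg_pos)
  define c where "c = 1 / ln (1 / \<theta>)"
  have lpos: "ln (1/\<theta>) > 0" using \<theta> by (simp add: ln_div)
  show ?thesis
  proof (rule that[of c])
    show "c > 0" using lpos by (simp add: c_def)
    fix A f M m z
    assume A: "finite A" "A \<subseteq> K" "f holomorphic_on ball 0 1" "\<And>w. w \<in> ball 0 1 \<Longrightarrow> norm (f w) \<le> M"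
      "\<And>a. a \<in> A \<Longrightarrow> f a = 0" "z \<in> K" "0 < m" "m \<le> norm (f z)"
    have zb: "z \<in> ball 0 1" using A assms by auto
    have M0: "M > 0" using A(4)[OF zb] A(7,8) by linarith
    have "m \<le> M * (\<Prod>a\<in>A. norm (Moebius_function 0 a z))"
      using bounded_holomorphic_le_Blaschke_product[OF A(1) order_trans[OF A(2) assms(2)] A(3,4,5) zb]
        A(8) by (meson order_trans)
    also have "\<dots> \<le> M * (\<Prod>a\<in>A. \<theta>)"
    proof (intro mult_left_mono prod_mono conjI)
      fix a assume "a \<in> A"
      then have "?\<mu> (a, z) \<le> ?\<mu> p" using A by (intro p(2)) auto
      then show "norm (Moebius_function 0 a z) \<le> \<theta>" using \<theta> by simp
    qed (use M0 in auto)
    also have "\<dots> = M * \<theta> ^ card A" by simp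
    finally have "(1/\<theta>) ^ card A \<le> M / m"
      using A \<theta> by (simp add: field_simps)
    then have "ln ((1/\<theta>) ^ card A) \<le> ln (M / m)"
      using \<theta> M0 A by (subst ln_le_cancel_iff) auto
    then have "real (card A) * ln (1/\<theta>) \<le> ln (M/m)"
      using \<theta> by (simp add: ln_realpow)
    then show "real (card A) \<le> c * ln (M / m)" using lpos by (simp add: c_def field_simps)
  qed
qed

text \<open>A Jensen-type count whose constant depends on the domain and the compact set alone; the Riemann
map reduces it to the disc. It is what turns exponential upper and lower bounds for a holomorphic
function into a linear bound for its zeros.\<close>

lemma zero_count:
  assumes D: "open D" "simply_connected D" "D \<noteq> UNIV" and K: "compact K" "K \<subseteq> D"
  obtains c where "c > 0"
    "\<And>A f M m z. \<lbrakk>finite A; A \<subseteq> K; f holomorphic_on D; \<And>w. w \<in> D \<Longrightarrow> norm (f w) \<le> M;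
        \<And>a. a \<in> A \<Longrightarrow> f a = 0; z \<in> K; 0 < m; m \<le> norm (f z)\<rbrakk> \<Longrightarrow> real (card A) \<le> c * ln (M / m)"
proof (cases "D = {}")
  case True
  show ?thesis by (rule that[of 1]) (use True K in auto)
next
  case False
  then obtain u v where uv: "u holomorphic_on D" "v holomorphic_on ball 0 1"
      "\<And>z. z \<in> D \<Longrightarrow> u z \<in> ball 0 1 \<and> v (u z) = z"
      "\<And>z. z \<in> ball 0 1 \<Longrightarrow> v z \<in> D \<and> u (v z) = z"
    using D Riemann_mapping_theorem[of D] by metis
  have "compact (u ` K)"
    using K uv(1) by (meson compact_continuous_image continuous_on_subset holomorphic_on_imp_continuous_on)
  moreover have "u ` K \<subseteq> ball 0 1" using K uv(3) by blast
  ultimately obtain c where c: "c > 0"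
    "\<And>A f M m z. \<lbrakk>finite A; A \<subseteq> u ` K; f holomorphic_on ball 0 1; \<And>w. w \<in> ball 0 1 \<Longrightarrow> norm (f w) \<le> M;
        \<And>a. a \<in> A \<Longrightarrow> f a = 0; z \<in> u ` K; 0 < m; m \<le> norm (f z)\<rbrakk> \<Longrightarrow> real (card A) \<le> c * ln (M / m)"
    by (rule zero_count_disc) blast
  show ?thesis
  proof (rule that[OF c(1)])
    fix A f M m z
    assume A: "finite A" "A \<subseteq> K" "f holomorphic_on D" "\<And>w. w \<in> D \<Longrightarrow> norm (f w) \<le> M"
      "\<And>a. a \<in> A \<Longrightarrow> f a = 0" "z \<in> K" "0 < m" "m \<le> norm (f z)"
    have inj: "inj_on u A" by (rule inj_on_inverseI[of _ v]) (use A K uv(3) in auto)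
    have "real (card (u ` A)) \<le> c * ln (M / m)"
    proof (rule c(2)[where f = "f \<circ> v" and z = "u z"])
      show "f \<circ> v holomorphic_on ball 0 1"
        by (rule holomorphic_on_compose_gen[OF uv(2) A(3)]) (use uv(4) in auto)
    qed (use A K uv(3,4) in auto)
    then show "real (card A) \<le> c * ln (M / m)" by (simp add: card_image[OF inj])
  qed
qed

section \<open>Integrals of compactly supported functions\<close>

lemma integrable_continuous_cball_support:
  fixes f :: "'a::euclidean_space \<Rightarrow> 'b::{banach,second_countable_topology}"
  assumes "continuous_on UNIV f" "\<And>x. x \<notin> cball x0 R \<Longrightarrow> f x = 0"
  shows "integrable lborel f"
proof -
  have "integrable lborel (\<lambda>x. indicator (cball x0 R) x *\<^sub>R f x)"
    using assms(1) continuous_on_subset by (intro borel_integrable_compact) auto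
  also have "(\<lambda>x. indicator (cball x0 R) x *\<^sub>R f x) = f"
    using assms(2) by (auto simp: indicator_def fun_eq_iff)
  finally show ?thesis .
qed

lemma lborel_integral_eq_integral_cbox:
  fixes f :: "'a::euclidean_space \<Rightarrow> 'b::euclidean_space"
  assumes "integrable lborel f" "\<And>x. x \<notin> cbox a b \<Longrightarrow> f x = 0"
  shows "(\<integral>x. f x \<partial>lborel) = integral (cbox a b) f"
proof -
  have "f = (\<lambda>x. if x \<in> cbox a b then f x else 0)" using assms(2) by (simp add: fun_eq_iff)
  then have "integral UNIV f = integral (cbox a b) f"
    using integral_restrict_UNIV[of "cbox a b" f] by simp
  then show ?thesis using integral_lborel[OF assms(1)] by simp
qed

lemma has_derivative_at_scaleR_lim:
  "(f has_derivative (\<lambda>h. h *\<^sub>R D)) (at (0::real)) \<longleftrightarrow> ((\<lambda>s. (f s - f 0) /\<^sub>R s) \<longlongrightarrow> D) (at 0)"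
proof -
  have "norm (f s - f 0 - s *\<^sub>R D) / norm s = norm ((f s - f 0) /\<^sub>R s - D)" if "s \<noteq> 0" for s
  proof -
    have "(f s - f 0) /\<^sub>R s - D = (f s - f 0 - s *\<^sub>R D) /\<^sub>R s"
      using that by (simp add: scaleR_diff_right)
    then show ?thesis by (simp add: divide_inverse mult.commute)
  qed
  then have "((\<lambda>s. norm (f s - f 0 - s *\<^sub>R D) / norm s) \<longlongrightarrow> 0) (at 0) \<longleftrightarrow>
        ((\<lambda>s. norm ((f s - f 0) /\<^sub>R s - D)) \<longlongrightarrow> 0) (at 0)"
    by (intro filterlim_cong refl) (auto simp: eventually_at_filter)
  also have "\<dots> \<longleftrightarrow> ((\<lambda>s. (f s - f 0) /\<^sub>R s) \<longlongrightarrow> D) (at 0)"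
    by (simp add: tendsto_norm_zero_iff Lim_null[of _ D])
  finally show ?thesis
    by (simp add: has_derivative_iff_norm bounded_linear_scaleR_left)
qed

text \<open>The integral of \<open>F\<close> is invariant under translation, so all difference quotients of
\<open>F\<close> have integral zero; dominated convergence passes this to the derivative. This is
the divergence theorem for compactly supported fields.\<close>

lemma integral_directional_derivative_eq_0:
  fixes F D :: "'a::euclidean_space \<Rightarrow> 'b::euclidean_space"
  assumes deriv: "\<And>x. ((\<lambda>s. F (x + s *\<^sub>R e)) has_vector_derivative D x) (at 0)"
    and cF: "continuous_on UNIV F" and cD: "continuous_on UNIV D"
    and F0: "\<And>x. x \<notin> cball x0 R \<Longrightarrow> F x = 0" and D0: "\<And>x. x \<notin> cball x0 R \<Longrightarrow> D x = 0"
  shows "(\<integral>x. D x \<partial>lborel) = 0"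
proof -
  have "bounded (D ` cball x0 R)"
    using cD by (meson compact_cball compact_continuous_image compact_imp_bounded continuous_on_subset subset_UNIV)
  then obtain M where M: "M > 0" "\<And>x. x \<in> cball x0 R \<Longrightarrow> norm (D x) \<le> M"
    unfolding bounded_pos by auto
  have DM: "norm (D x) \<le> M" for x using M D0[of x] by (cases "x \<in> cball x0 R") auto
  have deriv': "((\<lambda>s. F (x + s *\<^sub>R e)) has_vector_derivative D (x + t *\<^sub>R e)) (at t)" for x t
  proof -
    have "((\<lambda>s. F ((x + t *\<^sub>R e) + s *\<^sub>R e)) has_vector_derivative D (x + t *\<^sub>R e)) (at (t - t))"
      using deriv by simp
    moreover have "((\<lambda>s. s - t) has_vector_derivative 1) (at t)"
      by (auto intro!: derivative_eq_intros)
    ultimately have "((\<lambda>s. F ((x + t *\<^sub>R e) + s *\<^sub>R e)) \<circ> (\<lambda>s. s - t) has_vector_derivative 1 *\<^sub>R D (x + t *\<^sub>R e)) (at t)"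
      by (intro vector_diff_chain_at)
    moreover have "(\<lambda>s. F ((x + t *\<^sub>R e) + s *\<^sub>R e)) \<circ> (\<lambda>s. s - t) = (\<lambda>s. F (x + s *\<^sub>R e))"
      by (simp add: fun_eq_iff scaleR_diff_left)
    ultimately show ?thesis by simp
  qed
  have lip: "norm (F (x + s *\<^sub>R e) - F x) \<le> M * \<bar>s\<bar>" for x s
  proof -
    have "norm (F (x + s *\<^sub>R e) - F (x + 0 *\<^sub>R e)) \<le> M * norm (s - 0)"
    proof (rule differentiable_bound[of UNIV "\<lambda>s. F (x + s *\<^sub>R e)" "\<lambda>t h. h *\<^sub>R D (x + t *\<^sub>R e)"])
      fix t :: real
      show "((\<lambda>s. F (x + s *\<^sub>R e)) has_derivative (\<lambda>h. h *\<^sub>R D (x + t *\<^sub>R e))) (at t within UNIV)"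
        using deriv' unfolding has_vector_derivative_def by simp
      show "onorm (\<lambda>h. h *\<^sub>R D (x + t *\<^sub>R e)) \<le> M"
        by (rule onorm_le) (simp add: DM mult_left_mono mult.commute[of M])
    qed auto
    then show ?thesis by simp
  qed
  \<comment> \<open>Difference quotients with step \<open>1 / Suc n\<close>: their supports stay in the ball of radius \<open>R + norm e\<close>.\<close>
  define Q where "Q n x = (real (Suc n)) *\<^sub>R (F (x + (1 / real (Suc n)) *\<^sub>R e) - F x)" for n x
  have iF: "integrable lborel F" by (rule integrable_continuous_cball_support[OF cF F0])
  have shift: "integrable lborel (\<lambda>x. F (x + c))" "(\<integral>x. F (x + c) \<partial>lborel) = (\<integral>x. F x \<partial>lborel)" for c
  proof -
    have 1: "integrable (distr lborel borel ((+) c)) F" "(\<integral>x. F x \<partial>(distr lborel borel ((+) c))) = (\<integral>x. F x \<partial>lborel)"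
      using iF by (simp_all add: lborel_distr_plus)
    have bm: "F \<in> borel_measurable borel" using cF by (rule borel_measurable_continuous_onI)
    show "integrable lborel (\<lambda>x. F (x + c))"
      using 1(1) bm by (subst (asm) integrable_distr_eq) (auto simp: add.commute)
    show "(\<integral>x. F (x + c) \<partial>lborel) = (\<integral>x. F x \<partial>lborel)"
      using 1(2) bm by (subst (asm) integral_distr) (auto simp: add.commute)
  qed
  have "(\<lambda>n. \<integral>x. Q n x \<partial>lborel) \<longlonglongrightarrow> (\<integral>x. D x \<partial>lborel)"
  proof (rule integral_dominated_convergence[where w = "\<lambda>x. indicator (cball x0 (R + norm e)) x *\<^sub>R M"])
    show "D \<in> borel_measurable lborel" using cD borel_measurable_continuous_onI by auto
    have "continuous_on UNIV (Q n)" for n unfolding Q_def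
      by (intro continuous_intros continuous_on_compose2[OF cF]) auto
    then show "Q n \<in> borel_measurable lborel" for n using borel_measurable_continuous_onI by auto
    show "integrable lborel (\<lambda>x. indicator (cball x0 (R + norm e)) x *\<^sub>R M)"
      by (intro borel_integrable_compact) auto
    show "AE x in lborel. (\<lambda>n. Q n x) \<longlonglongrightarrow> D x"
    proof (intro AE_I2)
      fix x
      have "((\<lambda>s. (F (x + s *\<^sub>R e) - F x) /\<^sub>R s) \<longlongrightarrow> D x) (at 0)"
        using deriv[of x] by (simp add: has_vector_derivative_def has_derivative_at_scaleR_lim)
      moreover have "filterlim (\<lambda>n. 1 / real (Suc n)) (at 0) sequentially"
        unfolding filterlim_at using LIMSEQ_inverse_real_of_nat by (simp add: inverse_eq_divide)
      ultimately have "(\<lambda>n. (F (x + (1 / real (Suc n)) *\<^sub>R e) - F x) /\<^sub>R (1 / real (Suc n))) \<longlonglongrightarrow> D x"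
        by (rule filterlim_compose)
      then show "(\<lambda>n. Q n x) \<longlonglongrightarrow> D x" by (simp add: Q_def)
    qed
    fix n
    show "AE x in lborel. norm (Q n x) \<le> indicator (cball x0 (R + norm e)) x *\<^sub>R M"
    proof (intro AE_I2)
      fix x
      have "norm (Q n x) \<le> real (Suc n) * (M * \<bar>1 / real (Suc n)\<bar>)"
        unfolding Q_def norm_scaleR using lip[of x "1 / real (Suc n)"] by (intro mult_mono) auto
      then have b: "norm (Q n x) \<le> M" by simp
      show "norm (Q n x) \<le> indicator (cball x0 (R + norm e)) x *\<^sub>R M"
      proof (cases "x \<in> cball x0 (R + norm e)")
        case False
        then have "dist x0 x > R + norm e" by simp
        moreover have "dist x0 x \<le> dist x0 (x + (1 / real (Suc n)) *\<^sub>R e) + norm ((1 / real (Suc n)) *\<^sub>R e)"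
          using dist_triangle[of x0 x "x + (1 / real (Suc n)) *\<^sub>R e"] by (simp add: dist_norm)
        moreover have "norm ((1 / real (Suc n)) *\<^sub>R e) \<le> norm e"
          by (simp add: divide_le_eq algebra_simps)
        moreover have "0 \<le> norm e" by simp
        ultimately have "dist x0 (x + (1 / real (Suc n)) *\<^sub>R e) > R" "dist x0 x > R" by linarith+
        then have "Q n x = 0" by (simp add: Q_def F0)
        then show ?thesis using M by simp
      qed (use b in simp)
    qed
  qed
  moreover have "(\<integral>x. Q n x \<partial>lborel) = 0" for n
    unfolding Q_def using shift iF by simp
  ultimately show ?thesis by (simp add: LIMSEQ_const_iff)
qed

section \<open>A twice differentiable cutoff\<close>

text \<open>Powers of the positive part are differentiable from exponent 2 on; they are the building blocks of
a piecewise polynomial cutoff with two continuous derivatives.\<close>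

lemma DERIV_max0_power:
  "((\<lambda>x. (max 0 x) ^ (n + 2)) has_real_derivative real (n + 2) * (max 0 x) ^ (n + 1)) (at x)"
proof -
  consider "x < 0" | "x > 0" | "x = 0" by linarith
  then show ?thesis
  proof cases
    case 1
    have "((\<lambda>x. 0) has_real_derivative 0) (at x)" by simp
    then have "((\<lambda>x. (max 0 x) ^ (n + 2)) has_real_derivative 0) (at x)"
      by (rule has_field_derivative_transform_within_open[of _ _ _ "{..<0}"]) (use 1 in auto)
    then show ?thesis using 1 by simp
  next
    case 2
    have "((\<lambda>x. x ^ (n + 2)) has_real_derivative real (n + 2) * x ^ (n + 1)) (at x)"
      using DERIV_pow[of "n + 2" x] by simp
    then have "((\<lambda>x. (max 0 x) ^ (n + 2)) has_real_derivative real (n + 2) * x ^ (n + 1)) (at x)"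
      by (rule has_field_derivative_transform_within_open[of _ _ _ "{0<..}"]) (use 2 in auto)
    then show ?thesis using 2 by simp
  next
    case 3
    have "((\<lambda>h::real. (max 0 h) ^ (n + 2) / h) \<longlongrightarrow> 0) (at 0)"
    proof (rule Lim_null_comparison)
      have "norm (max 0 h ^ (n + 2) / h) \<le> \<bar>h\<bar> ^ (n + 1)" for h :: real
      proof (cases "h > 0")
        case False
        then have m: "max 0 h = 0" by simp
        show ?thesis unfolding m by simp
      qed simp
      then show "\<forall>\<^sub>F h in at 0. norm ((max 0 h) ^ (n + 2) / h) \<le> \<bar>h\<bar> ^ (n + 1)" for h :: real
        by simp
      have "((\<lambda>h::real. \<bar>h\<bar> ^ (n + 1)) \<longlongrightarrow> \<bar>0\<bar> ^ (n + 1)) (at 0)" by (intro tendsto_intros)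
      then show "((\<lambda>h::real. \<bar>h\<bar> ^ (n + 1)) \<longlongrightarrow> 0) (at 0)" by simp
    qed
    then show ?thesis using 3 by (simp add: DERIV_def)
  qed
qed

text \<open>With \<open>p x = (max 0 x) ^ 3\<close> the function \<open>p (1 - p (s - 1))\<close> equals 1 for
\<open>s \<le> 1\<close>, and 0 as soon as \<open>p (s - 1) \<ge> 1\<close>, that is, for \<open>s
\<ge> 2\<close>.\<close>

lemma smooth_step_exists:
  obtains k k1 k2 :: "real \<Rightarrow> real" where
    "\<And>s. (k has_real_derivative k1 s) (at s)" "\<And>s. (k1 has_real_derivative k2 s) (at s)"
    "continuous_on UNIV k2" "\<And>s. s \<le> 1 \<Longrightarrow> k s = 1 \<and> k1 s = 0 \<and> k2 s = 0"
    "\<And>s. s \<ge> 2 \<Longrightarrow> k s = 0 \<and> k1 s = 0 \<and> k2 s = 0"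
proof -
  define p p1 p2 :: "real \<Rightarrow> real"
    where "p = (\<lambda>x. max 0 x ^ 3)" and "p1 = (\<lambda>x. 3 * max 0 x ^ 2)" and "p2 = (\<lambda>x. 6 * max 0 x)"
  have p: "(p has_real_derivative p1 x) (at x)" for x
    using DERIV_max0_power[of 1 x] by (simp add: p_def p1_def eval_nat_numeral)
  have p1: "(p1 has_real_derivative p2 x) (at x)" for x
    using DERIV_cmult[OF DERIV_max0_power[of 0 x], of 3] by (simp add: p1_def p2_def eval_nat_numeral)
  have pc: "((\<lambda>x. p (f x)) has_real_derivative p1 (f x) * f') (at x)"
    if "(f has_real_derivative f') (at x)" for f f' x using DERIV_chain2[OF p that] .
  have p1c: "((\<lambda>x. p1 (f x)) has_real_derivative p2 (f x) * f') (at x)"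
    if "(f has_real_derivative f') (at x)" for f f' x using DERIV_chain2[OF p1 that] .
  have in': "((\<lambda>s. 1 - p (s - 1)) has_real_derivative - p1 (s - 1)) (at s)" for s
    using DERIV_diff[OF DERIV_const[of 1] pc[OF DERIV_diff[OF DERIV_ident DERIV_const[of 1]]]] by simp
  have sh: "((\<lambda>s. p1 (s - 1)) has_real_derivative p2 (s - 1)) (at s)" for s
    using p1c[OF DERIV_diff[OF DERIV_ident DERIV_const[of 1]]] by simp
  show thesis
  proof (rule that[of "\<lambda>s. p (1 - p (s - 1))" "\<lambda>s. - p1 (1 - p (s - 1)) * p1 (s - 1)"
        "\<lambda>s. p2 (1 - p (s - 1)) * (p1 (s - 1))\<^sup>2 - p1 (1 - p (s - 1)) * p2 (s - 1)"])
    fix s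
    show "((\<lambda>s. p (1 - p (s - 1))) has_real_derivative - p1 (1 - p (s - 1)) * p1 (s - 1)) (at s)"
      using pc[OF in', of s] by simp
    show "((\<lambda>s. - p1 (1 - p (s - 1)) * p1 (s - 1)) has_real_derivative
       p2 (1 - p (s - 1)) * (p1 (s - 1))\<^sup>2 - p1 (1 - p (s - 1)) * p2 (s - 1)) (at s)"
      using DERIV_mult[OF DERIV_minus[OF p1c[OF in', of s]] sh[of s]]
      by (simp add: power2_eq_square mult_ac)
  next
    show "continuous_on UNIV (\<lambda>s. p2 (1 - p (s - 1)) * (p1 (s - 1))\<^sup>2 - p1 (1 - p (s - 1)) * p2 (s - 1))"
      unfolding p_def p1_def p2_def by (intro continuous_intros)
  next
    fix s :: real assume s: "2 \<le> s"
    then have "1 ^ 3 \<le> (max 0 (s - 1)) ^ 3" by (intro power_mono) auto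
    then show "p (1 - p (s - 1)) = 0 \<and> - p1 (1 - p (s - 1)) * p1 (s - 1) = 0 \<and>
       p2 (1 - p (s - 1)) * (p1 (s - 1))\<^sup>2 - p1 (1 - p (s - 1)) * p2 (s - 1) = 0"
      by (simp add: p_def p1_def p2_def)
  qed (auto simp: p_def p1_def p2_def)
qed

definition has_partial :: "'n \<Rightarrow> (real^'n \<Rightarrow> 'b::real_normed_vector) \<Rightarrow> (real^'n \<Rightarrow> 'b) \<Rightarrow> bool" where
  "has_partial i f D \<longleftrightarrow> (\<forall>x. ((\<lambda>s. f (x + s *\<^sub>R axis i 1)) has_vector_derivative D x) (at 0))"

text \<open>The derivatives are carried along as explicit functions because Green's identity is applied to a
product with the cutoff. That they vanish on the half ball keeps the resulting error terms at a
distance from the centre, and at that distance the complexified heat kernel is small.\<close>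

definition cutoff ::
  "real \<Rightarrow> real \<Rightarrow> (real^2 \<Rightarrow> real) \<Rightarrow> (2 \<Rightarrow> real^2 \<Rightarrow> real) \<Rightarrow> (2 \<Rightarrow> real^2 \<Rightarrow> real) \<Rightarrow> bool" where
  "cutoff R A \<eta> \<eta>1 \<eta>2 \<longleftrightarrow>
     (\<forall>i. has_partial i \<eta> (\<eta>1 i) \<and> has_partial i (\<eta>1 i) (\<eta>2 i)) \<and>
     continuous_on UNIV \<eta> \<and> (\<forall>i. continuous_on UNIV (\<eta>1 i) \<and> continuous_on UNIV (\<eta>2 i)) \<and>
     (\<forall>w. norm (\<eta> w) \<le> A) \<and> (\<forall>w i. norm (\<eta>1 i w) \<le> A \<and> norm (\<eta>2 i w) \<le> A) \<and>
     (\<forall>w. norm w \<le> R / 2 \<longrightarrow> \<eta> w = 1 \<and> (\<forall>i. \<eta>1 i w = 0 \<and> \<eta>2 i w = 0)) \<and>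
     (\<forall>w. norm w \<ge> R \<longrightarrow> \<eta> w = 0 \<and> (\<forall>i. \<eta>1 i w = 0 \<and> \<eta>2 i w = 0))"

lemma bounded_of_cball_support:
  fixes f :: "'a::euclidean_space \<Rightarrow> real"
  assumes "continuous_on UNIV f" "\<And>w. norm w \<ge> R \<Longrightarrow> f w = 0"
  obtains B where "B > 0" "\<And>w. norm (f w) \<le> B"
proof -
  have "bounded (f ` cball 0 R)"
    using assms(1) by (meson compact_cball compact_continuous_image compact_imp_bounded continuous_on_subset subset_UNIV)
  then obtain B where B: "B > 0" "\<And>x. x \<in> cball 0 R \<Longrightarrow> norm (f x) \<le> B"
    unfolding bounded_pos by auto
  have "norm (f w) \<le> B" for w using B assms(2)[of w] by (cases "norm w \<le> R") auto
  then show thesis using that B by blast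
qed

lemma norm_add_axis_sq:
  fixes w :: "real^'n"
  shows "(norm (w + s *\<^sub>R axis i 1))\<^sup>2 = (norm w)\<^sup>2 + 2 * s * w $ i + s\<^sup>2"
proof -
  have "axis i 1 $ i = (1::real)" by (simp add: axis_def)
  then show ?thesis unfolding power2_norm_eq_inner
    by (simp add: inner_add_left inner_add_right inner_axis inner_axis' algebra_simps power2_eq_square)
qed

lemma cutoff_exists:
  assumes R: "R > 0"
  obtains A \<eta> \<eta>1 \<eta>2 where "A > 0" "cutoff R A \<eta> \<eta>1 \<eta>2"
proof -
  obtain k k1 k2 :: "real \<Rightarrow> real" where k:
    "\<And>s. (k has_real_derivative k1 s) (at s)" "\<And>s. (k1 has_real_derivative k2 s) (at s)"
    "continuous_on UNIV k2" "\<And>s. s \<le> 1 \<Longrightarrow> k s = 1 \<and> k1 s = 0 \<and> k2 s = 0"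
    "\<And>s. s \<ge> 2 \<Longrightarrow> k s = 0 \<and> k1 s = 0 \<and> k2 s = 0"
    using smooth_step_exists by metis
  \<comment> \<open>The step function drops from 1 to 0 between 1 and 2; \<open>\<sigma>\<close> is 1 on the sphere of radius \<open>R / 2\<close> and 4 on that of radius \<open>R\<close>.\<close>
  define \<sigma> where "\<sigma> w = 4 / R\<^sup>2 * (norm w)\<^sup>2" for w :: "real^2"
  define \<eta> where "\<eta> w = k (\<sigma> w)" for w
  define \<eta>1 where "\<eta>1 i w = k1 (\<sigma> w) * (8 / R\<^sup>2 * w $ i)" for i w
  define \<eta>2 where "\<eta>2 i w = k2 (\<sigma> w) * (8 / R\<^sup>2 * w $ i)\<^sup>2 + k1 (\<sigma> w) * (8 / R\<^sup>2)" for i :: 2 and w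
  have \<sigma>': "((\<lambda>s. \<sigma> (w + s *\<^sub>R axis i 1)) has_real_derivative 8 / R\<^sup>2 * w $ i) (at 0)" for w i
  proof -
    have "((\<lambda>s. c * (N + 2 * s * w $ i + s\<^sup>2)) has_real_derivative c * (2 * w $ i)) (at 0)" for c N
      by (auto intro!: derivative_eq_intros)
    from this[of "4 / R\<^sup>2" "(norm w)\<^sup>2"] show ?thesis
      unfolding \<sigma>_def norm_add_axis_sq by simp
  qed
  have w': "((\<lambda>s. (w + s *\<^sub>R axis i 1) $ i) has_real_derivative 1) (at 0)" for w :: "real^2" and i
    by (auto intro!: derivative_eq_intros simp: axis_def)
  have p1: "has_partial i \<eta> (\<eta>1 i)" for i
    unfolding has_partial_def \<eta>_def \<eta>1_def
    using DERIV_chain2[OF k(1) \<sigma>'] by (simp add: has_real_derivative_iff_has_vector_derivative)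
  have p2: "has_partial i (\<eta>1 i) (\<eta>2 i)" for i
  proof -
    have "((\<lambda>s. \<eta>1 i (w + s *\<^sub>R axis i 1)) has_real_derivative \<eta>2 i w) (at 0)" for w
      unfolding \<eta>1_def \<eta>2_def
      using DERIV_mult[OF DERIV_chain2[OF k(2) \<sigma>'] DERIV_cmult[OF w', of "8 / R\<^sup>2"], of w i w i]
      by (simp add: power2_eq_square mult_ac add.commute)
    then show ?thesis by (simp add: has_partial_def has_real_derivative_iff_has_vector_derivative)
  qed
  have ck: "continuous_on UNIV k" "continuous_on UNIV k1"
    using k(1,2) by (meson DERIV_isCont continuous_at_imp_continuous_on)+
  have c\<sigma>: "continuous_on UNIV \<sigma>" unfolding \<sigma>_def by (intro continuous_intros) (use R in auto)
  note cc = continuous_on_compose2[OF ck(1) c\<sigma>] continuous_on_compose2[OF ck(2) c\<sigma>] continuous_on_compose2[OF k(3) c\<sigma>]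
  have c: "continuous_on UNIV \<eta>" "continuous_on UNIV (\<eta>1 i)" "continuous_on UNIV (\<eta>2 i)" for i
    unfolding \<eta>_def \<eta>1_def \<eta>2_def by (intro continuous_intros cc; use R in auto)+
  have in': "\<sigma> w \<le> 1" if "norm w \<le> R/2" for w
  proof -
    have "(norm w)\<^sup>2 \<le> (R/2)\<^sup>2" using that by (intro power_mono) auto
    then show ?thesis using R by (simp add: \<sigma>_def power_divide)
  qed
  have out: "\<sigma> w \<ge> 2" if "norm w \<ge> R" for w
  proof -
    have "(norm w)\<^sup>2 \<ge> R\<^sup>2" using that R by (intro power_mono) auto
    then have "4 / R\<^sup>2 * R\<^sup>2 \<le> \<sigma> w" unfolding \<sigma>_def by (intro mult_left_mono) auto
    then show ?thesis using R by simp
  qed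
  have van: "\<eta> w = 0 \<and> (\<forall>i. \<eta>1 i w = 0 \<and> \<eta>2 i w = 0)" if "norm w \<ge> R" for w
    using k(5)[OF out[OF that]] by (simp add: \<eta>_def \<eta>1_def \<eta>2_def)
  have const: "\<eta> w = 1 \<and> (\<forall>i. \<eta>1 i w = 0 \<and> \<eta>2 i w = 0)" if "norm w \<le> R/2" for w
    using k(4)[OF in'[OF that]] by (simp add: \<eta>_def \<eta>1_def \<eta>2_def)
  have B: "\<exists>B. B > 0 \<and> (\<forall>w. norm (\<eta> w) \<le> B)" "\<And>i. \<exists>B. B > 0 \<and> (\<forall>w. norm (\<eta>1 i w) \<le> B)"
    "\<And>i. \<exists>B. B > 0 \<and> (\<forall>w. norm (\<eta>2 i w) \<le> B)"
    using bounded_of_cball_support[OF c(1), of R] bounded_of_cball_support[OF c(2), of R]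
      bounded_of_cball_support[OF c(3), of R] van by metis+
  from B obtain a where a: "a > 0" "\<And>w. norm (\<eta> w) \<le> a" by blast
  from B obtain b where b: "\<And>i. b i > 0" "\<And>i w. norm (\<eta>1 i w) \<le> b i" by metis
  from B obtain d where d: "\<And>i. d i > 0" "\<And>i w. norm (\<eta>2 i w) \<le> d i" by metis
  define A where "A = a + (\<Sum>i\<in>UNIV. b i) + (\<Sum>i\<in>UNIV. d i)"
  have s: "b i \<le> (\<Sum>i\<in>UNIV. b i)" "d i \<le> (\<Sum>i\<in>UNIV. d i)" for i
    using b d by (intro member_le_sum; simp add: less_imp_le)+
  have s0: "(\<Sum>i\<in>UNIV. b i) \<ge> 0" "(\<Sum>i\<in>UNIV. d i) \<ge> 0" using b d by (auto intro!: sum_nonneg simp: less_imp_le)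
  have "norm (\<eta> w) \<le> A" "norm (\<eta>1 i w) \<le> A" "norm (\<eta>2 i w) \<le> A" for i w
    using a(1) a(2)[of w] b(2)[of i w] d(2)[of i w] s[of i] s0 unfolding A_def by linarith+
  moreover have "A > 0" using a s0 by (simp add: A_def)
  ultimately show thesis using that[of A \<eta> \<eta>1 \<eta>2] p1 p2 c van const unfolding cutoff_def by blast
qed

section \<open>Green's identity\<close>

lemma has_vector_derivative_partial:
  assumes "f differentiable (at x)"
  shows "((\<lambda>s. f (x + s *\<^sub>R axis i 1)) has_vector_derivative partial_deriv i f x) (at 0)"
proof -
  have f: "(f has_derivative frechet_derivative f (at x)) (at (x + 0 *\<^sub>R axis i 1))"
    using assms frechet_derivative_works by auto
  have "((\<lambda>s. x + s *\<^sub>R axis i (1::real)) has_derivative (\<lambda>s. s *\<^sub>R axis i 1)) (at 0)"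
    by (auto intro!: derivative_eq_intros)
  from has_derivative_compose[OF this f]
  have "((\<lambda>s. f (x + s *\<^sub>R axis i 1)) has_derivative (\<lambda>s. frechet_derivative f (at x) (s *\<^sub>R axis i 1))) (at 0)" .
  moreover have "linear (frechet_derivative f (at x))"
    using assms by (rule linear_frechet_derivative)
  ultimately show ?thesis
    by (simp add: has_vector_derivative_def partial_deriv_def linear_scale)
qed

lemma continuous_on_UNIV_of_cball_support:
  fixes f :: "'a::euclidean_space \<Rightarrow> 'b::real_normed_vector"
  assumes "open \<Omega>" "cball x0 R \<subseteq> \<Omega>" "continuous_on \<Omega> f" "\<And>x. x \<notin> cball x0 R \<Longrightarrow> f x = 0"
  shows "continuous_on UNIV f"
proof -
  have "continuous_on (- cball x0 R) f"
    by (rule continuous_on_eq[OF continuous_on_const[of _ 0]]) (use assms(4) in auto)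
  then have "continuous_on (\<Omega> \<union> - cball x0 R) f"
    using assms by (intro continuous_on_open_Un) auto
  moreover have "\<Omega> \<union> - cball x0 R = UNIV" using assms(2) by auto
  ultimately show ?thesis by simp
qed

lemma has_vector_derivative_complex_of_real:
  "(f has_vector_derivative D) F \<Longrightarrow> ((\<lambda>s. complex_of_real (f s)) has_vector_derivative of_real D) F"
  by (intro has_vector_derivative_of_real) (simp add: has_real_derivative_iff_has_vector_derivative)

text \<open>Green's second identity: for each coordinate the integrand difference is the partial derivative of
\<open>\<phi> * \<psi>' - \<phi>' * \<psi>\<close>, which is continuous on the whole plane because
\<open>\<psi>\<close> and \<open>\<psi>'\<close> vanish off a ball inside \<open>\<Omega>\<close>.\<close>

lemma Green_identity_compact_support:
  fixes \<psi> :: "real^2 \<Rightarrow> complex"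
  assumes O: "open \<Omega>" "cball x0 R \<subseteq> \<Omega>" and \<phi>: "C2_on \<Omega> \<phi>"
    and d1: "\<And>i. has_partial i \<psi> (\<psi>1 i)" and d2: "\<And>i. has_partial i (\<psi>1 i) (\<psi>2 i)"
    and c: "continuous_on UNIV \<psi>" "\<And>i. continuous_on UNIV (\<psi>1 i)" "\<And>i. continuous_on UNIV (\<psi>2 i)"
    and van: "\<And>x. x \<notin> cball x0 R \<Longrightarrow> \<psi> x = 0" "\<And>x i. x \<notin> cball x0 R \<Longrightarrow> \<psi>1 i x = 0"
      "\<And>x i. x \<notin> cball x0 R \<Longrightarrow> \<psi>2 i x = 0"
  shows "(\<integral>x. of_real (\<phi> x) * (\<Sum>i\<in>UNIV. \<psi>2 i x) \<partial>lborel) = (\<integral>x. of_real (laplacian \<phi> x) * \<psi> x \<partial>lborel)"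
proof -
  let ?P = "\<lambda>i. partial_deriv i \<phi>"
  let ?PP = "\<lambda>i. partial_deriv i (partial_deriv i \<phi>)"
  have c\<phi>: "continuous_on \<Omega> \<phi>" "\<And>i. continuous_on \<Omega> (?P i)" "\<And>i. continuous_on \<Omega> (?PP i)"
    and d\<phi>: "\<And>x. x \<in> \<Omega> \<Longrightarrow> \<phi> differentiable (at x)" "\<And>x i. x \<in> \<Omega> \<Longrightarrow> ?P i differentiable (at x)"
    using \<phi> O(1) by (auto simp: C2_on_def C1_on_def continuous_on_eq_continuous_at
        intro!: differentiable_imp_continuous_within)
  have cO: "continuous_on \<Omega> \<psi>" "\<And>i. continuous_on \<Omega> (\<psi>1 i)" "\<And>i. continuous_on \<Omega> (\<psi>2 i)"
    using c continuous_on_subset by blast+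
  have i: "integrable lborel (\<lambda>x. of_real (\<phi> x) * \<psi>2 i x)" "integrable lborel (\<lambda>x. of_real (?PP i x) * \<psi> x)" for i
    by (rule integrable_continuous_cball_support[where R=R and ?x0.0=x0];
        (rule continuous_on_UNIV_of_cball_support[OF O])?; auto intro!: continuous_intros c\<phi> cO simp: van)+
  have "(\<integral>x. of_real (\<phi> x) * \<psi>2 i x - of_real (?PP i x) * \<psi> x \<partial>lborel) = 0" for i
  proof (rule integral_directional_derivative_eq_0[where ?x0.0=x0 and R=R and e="axis i 1"
        and F="\<lambda>x. of_real (\<phi> x) * \<psi>1 i x - of_real (?P i x) * \<psi> x"])
    fix x
    let ?F = "\<lambda>s. of_real (\<phi> (x + s *\<^sub>R axis i 1)) * \<psi>1 i (x + s *\<^sub>R axis i 1) -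
              of_real (?P i (x + s *\<^sub>R axis i 1)) * \<psi> (x + s *\<^sub>R axis i 1)"
    show "(?F has_vector_derivative of_real (\<phi> x) * \<psi>2 i x - of_real (?PP i x) * \<psi> x) (at 0)"
    proof (cases "x \<in> \<Omega>")
      case True
      note a = has_vector_derivative_complex_of_real[OF has_vector_derivative_partial[OF d\<phi>(1)[OF True], of i]]
      note b = has_vector_derivative_complex_of_real[OF has_vector_derivative_partial[OF d\<phi>(2)[OF True], of i i]]
      have e: "((\<lambda>s. \<psi> (x + s *\<^sub>R axis i 1)) has_vector_derivative \<psi>1 i x) (at 0)"
        "((\<lambda>s. \<psi>1 i (x + s *\<^sub>R axis i 1)) has_vector_derivative \<psi>2 i x) (at 0)"
        using d1 d2 by (auto simp: has_partial_def)
      show ?thesis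
        using has_vector_derivative_diff[OF has_vector_derivative_mult[OF a e(2)] has_vector_derivative_mult[OF b e(1)]]
        by (simp add: algebra_simps)
    next
      case False
      then have x: "x \<notin> cball x0 R" using O by auto
      have "open ((\<lambda>s. x + s *\<^sub>R axis i (1::real)) -` (- cball x0 R))"
        by (intro open_vimage) (auto intro!: continuous_intros)
      with has_vector_derivative_const[of 0 "at (0::real)"] have "(?F has_vector_derivative 0) (at 0)"
        by (rule has_vector_derivative_transform_within_open) (use x van in auto)
      then show ?thesis using x by (simp add: van)
    qed
  next
    show "continuous_on UNIV (\<lambda>x. of_real (\<phi> x) * \<psi>1 i x - of_real (?P i x) * \<psi> x)"
      "continuous_on UNIV (\<lambda>x. of_real (\<phi> x) * \<psi>2 i x - of_real (?PP i x) * \<psi> x)"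
      by (rule continuous_on_UNIV_of_cball_support[OF O]; auto intro!: continuous_intros c\<phi> cO simp: van)+
  qed (auto simp: van)
  then have eq: "(\<integral>x. of_real (\<phi> x) * \<psi>2 i x \<partial>lborel) = (\<integral>x. of_real (?PP i x) * \<psi> x \<partial>lborel)" for i
    using i by (subst (asm) Bochner_Integration.integral_diff) auto
  show ?thesis
    unfolding laplacian_def of_real_sum sum_distrib_left sum_distrib_right
    using i eq by (subst (1 2) Bochner_Integration.integral_sum) auto
qed

section \<open>Heat evolution of a localized eigenfunction\<close>

text \<open>The squared distance continued to complex first argument; holomorphic in that argument, hence
without complex conjugation.\<close>

definition sq_dist :: "complex^2 \<Rightarrow> real^2 \<Rightarrow> complex" where
  "sq_dist P w = (\<Sum>i\<in>UNIV. (P $ i - of_real (w $ i))\<^sup>2)"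

text \<open>The two-dimensional heat kernel up to the constant factor \<open>4 * pi\<close>, continued to
complex first argument. The next two functions are its first and second partial derivatives with
respect to \<open>w $ i\<close>.\<close>

definition gauss :: "real \<Rightarrow> complex^2 \<Rightarrow> real^2 \<Rightarrow> complex" where
  "gauss t P w = exp (- sq_dist P w / (4 * of_real t)) / of_real t"

definition gauss_d1 :: "2 \<Rightarrow> real \<Rightarrow> complex^2 \<Rightarrow> real^2 \<Rightarrow> complex" where
  "gauss_d1 i t P w = gauss t P w * ((P $ i - of_real (w $ i)) / (2 * of_real t))"

definition gauss_d2 :: "2 \<Rightarrow> real \<Rightarrow> complex^2 \<Rightarrow> real^2 \<Rightarrow> complex" where
  "gauss_d2 i t P w =
     gauss t P w * ((P $ i - of_real (w $ i))\<^sup>2 / (4 * (of_real t)\<^sup>2) - 1 / (2 * of_real t))"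

lemma sq_dist_add_axis:
  "sq_dist P (w + s *\<^sub>R axis i 1) = sq_dist P w - 2 * of_real s * (P $ i - of_real (w $ i)) + (of_real s)\<^sup>2"
proof -
  have "sq_dist P (w + s *\<^sub>R axis i 1) =
     (\<Sum>j\<in>UNIV. (P $ j - of_real (w $ j))\<^sup>2 +
        (if j = i then - 2 * of_real s * (P $ i - of_real (w $ i)) + (of_real s)\<^sup>2 else 0))"
    unfolding sq_dist_def by (intro sum.cong) (auto simp: axis_def power2_eq_square algebra_simps)
  then show ?thesis by (simp add: sq_dist_def sum.distrib)
qed

lemma has_partial_gauss:
  assumes "t \<noteq> 0"
  shows "has_partial i (gauss t P) (gauss_d1 i t P)"
  unfolding has_partial_def
proof
  fix w
  let ?d = "P $ i - of_real (w $ i)"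
  have "((\<lambda>\<sigma>. - (sq_dist P w - 2 * \<sigma> * ?d + \<sigma>\<^sup>2) / (4 * of_real t)) has_field_derivative ?d / (2 * of_real t)) (at (of_real 0))"
    using assms by (auto intro!: derivative_eq_intros simp: field_simps)
  note DERIV_cdivide[OF DERIV_chain2[OF DERIV_exp this], of "of_real t"]
  moreover have "exp (- (sq_dist P w - 2 * of_real 0 * ?d + (of_real 0)\<^sup>2) / (4 * of_real t)) * (?d / (2 * of_real t)) / of_real t =
      gauss_d1 i t P w"
    by (simp add: gauss_d1_def gauss_def)
  ultimately have "((\<lambda>\<sigma>. exp (- (sq_dist P w - 2 * \<sigma> * ?d + \<sigma>\<^sup>2) / (4 * of_real t)) / of_real t) has_field_derivative
      gauss_d1 i t P w) (at (of_real 0))"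
    by metis
  then show "((\<lambda>s. gauss t P (w + s *\<^sub>R axis i 1)) has_vector_derivative gauss_d1 i t P w) (at 0)"
    unfolding gauss_def sq_dist_add_axis by (rule has_vector_derivative_real_field)
qed

lemma has_partial_gauss_d1:
  assumes "t \<noteq> 0"
  shows "has_partial i (gauss_d1 i t P) (gauss_d2 i t P)"
  unfolding has_partial_def
proof
  fix w
  have a: "((\<lambda>s. gauss t P (w + s *\<^sub>R axis i 1)) has_vector_derivative gauss_d1 i t P w) (at 0)"
    using has_partial_gauss[OF assms] by (simp add: has_partial_def)
  have "((\<lambda>\<sigma>. (P $ i - of_real (w $ i) - \<sigma>) / (2 * of_real t)) has_field_derivative - 1 / (2 * of_real t)) (at (of_real 0))"
    using assms by (auto intro!: derivative_eq_intros)
  then have "((\<lambda>s. (P $ i - of_real (w $ i) - of_real s) / (2 * of_real t)) has_vector_derivative - 1 / (2 * of_real t)) (at 0)"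
    by (rule has_vector_derivative_real_field)
  then have b: "((\<lambda>s. (P $ i - of_real ((w + s *\<^sub>R axis i 1) $ i)) / (2 * of_real t)) has_vector_derivative - 1 / (2 * of_real t)) (at 0)"
    by (simp add: axis_def algebra_simps)
  show "((\<lambda>s. gauss_d1 i t P (w + s *\<^sub>R axis i 1)) has_vector_derivative gauss_d2 i t P w) (at 0)"
  proof -
    have "gauss t P (w + 0 *\<^sub>R axis i 1) * (- 1 / (2 * of_real t)) +
       gauss_d1 i t P w * ((P $ i - of_real ((w + 0 *\<^sub>R axis i 1) $ i)) / (2 * of_real t)) = gauss_d2 i t P w"
    proof -
      have *: "g * (- 1 / (2 * c)) + g * (d / (2 * c)) * (d / (2 * c)) = g * (d\<^sup>2 / (4 * c\<^sup>2) - 1 / (2 * c))" for g c d :: complex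
        by (simp add: power2_eq_square right_diff_distrib)
      show ?thesis unfolding gauss_d1_def gauss_d2_def scaleR_zero_left add_0_right by (rule *)
    qed
    then show ?thesis
      using has_vector_derivative_mult[OF a b] unfolding gauss_d1_def[of i t P "_ + _"] by simp
  qed
qed

lemma heat_equation_gauss:
  assumes "t \<noteq> 0"
  shows "((\<lambda>t. gauss t P w) has_vector_derivative (\<Sum>i\<in>UNIV. gauss_d2 i t P w)) (at t)"
proof -
  let ?t = "of_real t :: complex"
  have "(\<Sum>i\<in>UNIV. gauss_d2 i t P w) = gauss t P w * (sq_dist P w / (4 * ?t\<^sup>2) - 1 / ?t)"
    by (simp add: gauss_d2_def sq_dist_def sum_distrib_left[symmetric] sum_subtractf sum_divide_distrib[symmetric])
  moreover have "((\<lambda>\<tau>. exp (- sq_dist P w / (4 * \<tau>)) / \<tau>) has_field_derivative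
     gauss t P w * (sq_dist P w / (4 * ?t\<^sup>2) - 1 / ?t)) (at ?t)"
    using assms unfolding gauss_def
    by (auto intro!: derivative_eq_intros simp: field_simps power2_eq_square)
  ultimately show ?thesis unfolding gauss_def
    using has_vector_derivative_real_field[of "\<lambda>\<tau>. exp (- sq_dist P w / (4 * \<tau>)) / \<tau>"] by simp
qed

lemma continuous_on_sq_dist [continuous_intros]:
  fixes P :: "'a::topological_space \<Rightarrow> complex^2"
  assumes "\<And>i. continuous_on S (\<lambda>x. P x $ i)" "continuous_on S g"
  shows "continuous_on S (\<lambda>x. sq_dist (P x) (g x))"
  unfolding sq_dist_def by (intro continuous_intros assms)

lemma continuous_on_gauss [continuous_intros]:
  fixes P :: "'a::topological_space \<Rightarrow> complex^2"
  assumes "continuous_on S f" "\<And>i. continuous_on S (\<lambda>x. P x $ i)" "continuous_on S g" "\<And>x. x \<in> S \<Longrightarrow> f x \<noteq> 0"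
  shows "continuous_on S (\<lambda>x. gauss (f x) (P x) (g x))"
    "continuous_on S (\<lambda>x. gauss_d1 i (f x) (P x) (g x))"
    "continuous_on S (\<lambda>x. gauss_d2 i (f x) (P x) (g x))"
proof -
  show *: "continuous_on S (\<lambda>x. gauss (f x) (P x) (g x))" unfolding gauss_def
    by (intro continuous_intros assms) (use assms in auto)
  show "continuous_on S (\<lambda>x. gauss_d1 i (f x) (P x) (g x))"
    "continuous_on S (\<lambda>x. gauss_d2 i (f x) (P x) (g x))" unfolding gauss_d1_def gauss_d2_def
    by (intro continuous_intros assms *; use assms in auto)+
qed

lemma has_partial_shift:
  assumes "has_partial i f D" shows "has_partial i (\<lambda>w. f (w - c)) (\<lambda>w. D (w - c))"
proof -
  have "(w + s *\<^sub>R axis i 1) - c = (w - c) + s *\<^sub>R axis i 1" for w s by simp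
  note eq = this
  show ?thesis using assms unfolding has_partial_def eq by blast
qed

lemma has_partial_of_real:
  assumes "has_partial i f D" shows "has_partial i (\<lambda>w. complex_of_real (f w)) (\<lambda>w. of_real (D w))"
  using assms has_vector_derivative_complex_of_real unfolding has_partial_def by blast

lemma has_partial_mult:
  fixes f g :: "real^'n \<Rightarrow> 'b::real_normed_algebra"
  assumes "has_partial i f D" "has_partial i g E"
  shows "has_partial i (\<lambda>w. f w * g w) (\<lambda>w. f w * E w + D w * g w)"
  unfolding has_partial_def
proof
  fix x
  show "((\<lambda>s. f (x + s *\<^sub>R axis i 1) * g (x + s *\<^sub>R axis i 1)) has_vector_derivative f x * E x + D x * g x) (at 0)"
    using has_vector_derivative_mult[of "\<lambda>s. f (x + s *\<^sub>R axis i 1)" "D x" 0 UNIV "\<lambda>s. g (x + s *\<^sub>R axis i 1)" "E x"]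
      assms by (simp add: has_partial_def)
qed

lemma has_partial_add:
  assumes "has_partial i f D" "has_partial i g E"
  shows "has_partial i (\<lambda>w. f w + g w) (\<lambda>w. D w + E w)"
  using assms has_vector_derivative_add unfolding has_partial_def by blast

text \<open>The centre \<open>x0\<close> will run through the curve while \<open>R\<close>, \<open>A\<close>
and the cutoff profile stay fixed, so bounds in terms of \<open>R\<close> and \<open>A\<close> are
uniform along the curve.\<close>

locale localized_eigenfunction =
  fixes \<Omega> :: "(real^2) set" and \<phi> :: "real^2 \<Rightarrow> real" and x0 :: "real^2" and R A lam :: real
    and \<eta> :: "real^2 \<Rightarrow> real" and \<eta>1 \<eta>2 :: "2 \<Rightarrow> real^2 \<Rightarrow> real"
  assumes R: "R > 0" and A: "A > 0" and O: "open \<Omega>" "cball x0 R \<subseteq> \<Omega>"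
    and \<phi>: "C2_on \<Omega> \<phi>" and eig: "\<And>x. x \<in> \<Omega> \<Longrightarrow> - laplacian \<phi> x = lam\<^sup>2 * \<phi> x"
    and cut: "cutoff R A \<eta> \<eta>1 \<eta>2"
begin

definition localized :: "real^2 \<Rightarrow> real" where "localized w = \<eta> (w - x0) * \<phi> w"

definition heat :: "real \<Rightarrow> complex^2 \<Rightarrow> complex" where
  "heat t P = (\<integral>w. gauss t P w * of_real (localized w) \<partial>lborel)"

text \<open>This is \<open>\<Delta> (gauss * \<eta>) - \<eta> * \<Delta> gauss\<close>, the commutator of the
Laplacian with the cutoff, applied to the kernel. It is supported where \<open>\<eta>\<close>
varies, at distance at least \<open>R / 2\<close> from \<open>x0\<close>.\<close>

definition commutator :: "real \<Rightarrow> complex^2 \<Rightarrow> real^2 \<Rightarrow> complex" where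
  "commutator t P w = (\<Sum>i\<in>UNIV. 2 * gauss_d1 i t P w * of_real (\<eta>1 i (w - x0)) + gauss t P w * of_real (\<eta>2 i (w - x0)))"

definition source :: "real \<Rightarrow> complex^2 \<Rightarrow> complex" where
  "source t P = (\<integral>w. of_real (\<phi> w) * commutator t P w \<partial>lborel)"

lemma cutoff_outside: "x \<notin> cball x0 R \<Longrightarrow> \<eta> (x - x0) = 0" "x \<notin> cball x0 R \<Longrightarrow> \<eta>1 i (x - x0) = 0" "x \<notin> cball x0 R \<Longrightarrow> \<eta>2 i (x - x0) = 0"
  using cut by (auto simp: cutoff_def dist_norm norm_minus_commute)

lemma continuous_on_phi: "continuous_on \<Omega> \<phi>"
  using \<phi> O(1) differentiable_imp_continuous_within
  unfolding C2_on_def C1_on_def continuous_on_eq_continuous_at[OF O(1)] by blast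

lemma continuous_on_cutoff: "continuous_on S (\<lambda>w. \<eta> (w - x0))" "continuous_on S (\<lambda>w. \<eta>1 i (w - x0))" "continuous_on S (\<lambda>w. \<eta>2 i (w - x0))"
proof -
  have c: "continuous_on UNIV \<eta>" "continuous_on UNIV (\<eta>1 i)" "continuous_on UNIV (\<eta>2 i)" using cut by (auto simp: cutoff_def)
  have d: "continuous_on S (\<lambda>w. w - x0)" by (intro continuous_intros)
  show "continuous_on S (\<lambda>w. \<eta> (w - x0))" "continuous_on S (\<lambda>w. \<eta>1 i (w - x0))" "continuous_on S (\<lambda>w. \<eta>2 i (w - x0))"
    by (rule continuous_on_compose2[OF _ d], rule c, simp)+
qed

lemma localized_outside: "x \<notin> cball x0 R \<Longrightarrow> localized x = 0"
  by (simp add: localized_def cutoff_outside)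

lemma continuous_on_localized: "continuous_on UNIV localized"
  by (rule continuous_on_UNIV_of_cball_support[OF O])
     (auto simp: localized_def cutoff_outside intro!: continuous_intros continuous_on_phi continuous_on_cutoff)

lemma continuous_on_localized_compose: "continuous_on S g \<Longrightarrow> continuous_on S (\<lambda>x. localized (g x))"
  using continuous_on_compose2[OF continuous_on_localized] by blast

lemma integrable_localized:
  assumes "continuous_on UNIV g"
  shows "integrable lborel (\<lambda>w. g w * complex_of_real (localized w))"
proof (rule integrable_continuous_cball_support)
  show "continuous_on UNIV (\<lambda>w. g w * complex_of_real (localized w))"
    by (intro continuous_intros assms continuous_on_localized)
  show "g w * complex_of_real (localized w) = 0" if "w \<notin> cball x0 R" for w
    using localized_outside[OF that] by simp
qed

lemma continuous_on_gauss_space: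
  assumes "t > 0"
  shows "continuous_on S (gauss t P)" "continuous_on S (gauss_d1 i t P)" "continuous_on S (gauss_d2 i t P)"
  using assms by (intro continuous_on_gauss continuous_on_const continuous_on_id; simp)+

lemma heat_has_vector_derivative:
  assumes t: "t > 0"
  shows "((\<lambda>t. heat t P) has_vector_derivative (\<integral>w. (\<Sum>i\<in>UNIV. gauss_d2 i t P w) * of_real (localized w) \<partial>lborel)) (at t)"
proof -
  obtain a b where ab: "cball x0 R \<subseteq> cbox a b"
    using bounded_subset_cbox_symmetric[OF bounded_cball] by metis
  have v0: "localized w = 0" if "w \<notin> cbox a b" for w using localized_outside[of w] ab that by blast
  let ?f' = "\<lambda>t w. (\<Sum>i\<in>UNIV. gauss_d2 i t P w) * of_real (localized w)"
  have int: "integrable lborel (\<lambda>w. gauss t P w * of_real (localized w))" "integrable lborel (?f' t)" if "t > 0" for t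
    by (intro integrable_localized continuous_on_sum continuous_on_gauss_space that)+
  have L1: "((\<lambda>t. gauss t P w * of_real (localized w)) has_vector_derivative ?f' t w) (at t within {0<..})" if "t \<in> {0<..}" for t w
  proof -
    have "t \<noteq> 0" using that by simp
    then show ?thesis
      by (rule has_vector_derivative_at_within[OF has_vector_derivative_mult_left[OF heat_equation_gauss]])
  qed
  have c1: "continuous_on S (\<lambda>w. complex_of_real (localized w))" for S
    by (intro continuous_on_of_real continuous_on_subset[OF continuous_on_localized]) simp
  have L2: "(\<lambda>w. gauss t P w * of_real (localized w)) integrable_on cbox a b" if "t \<in> {0<..}" for t
  proof -
    have "t > 0" using that by simp
    then show ?thesis by (intro integrable_continuous continuous_on_mult continuous_on_gauss_space(1) c1)
  qed
  have c2: "continuous_on ({0<..} \<times> cbox a b) (\<lambda>p. gauss_d2 i (fst p) P (snd p))" for i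
    by (rule continuous_on_gauss(3)) (auto intro!: continuous_intros)
  have c3: "continuous_on ({0<..} \<times> cbox a b) (\<lambda>p::real \<times> _. complex_of_real (localized (snd p)))"
    by (intro continuous_on_of_real continuous_on_compose2[OF continuous_on_localized] continuous_on_snd continuous_on_id) simp
  have L3: "continuous_on ({0<..} \<times> cbox a b) (\<lambda>(t, w). ?f' t w)"
    unfolding split_beta by (intro continuous_on_mult continuous_on_sum c2 c3)
  have "((\<lambda>t. integral (cbox a b) (\<lambda>w. gauss t P w * of_real (localized w))) has_vector_derivative
         integral (cbox a b) (?f' t)) (at t within {0<..})"
    by (rule leibniz_rule_vector_derivative[where f = "\<lambda>t w. gauss t P w * of_real (localized w)" and fx = ?f', OF L1 L2 L3])
      (use t in auto)
  then have "((\<lambda>t. integral (cbox a b) (\<lambda>w. gauss t P w * of_real (localized w))) has_vector_derivative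
         integral (cbox a b) (?f' t)) (at t)"
    using t at_within_open[of t "{0<..}"] by simp
  then have D: "((\<lambda>t. integral (cbox a b) (\<lambda>w. gauss t P w * of_real (localized w))) has_vector_derivative
         (\<integral>w. ?f' t w \<partial>lborel)) (at t)"
    using lborel_integral_eq_integral_cbox[OF int(2)[OF t], of a b] v0 by simp
  have "integral (cbox a b) (\<lambda>w. gauss t P w * of_real (localized w)) = heat t P" if "t \<in> {0<..}" for t
    unfolding heat_def using lborel_integral_eq_integral_cbox[OF int(1), of t a b] that v0 by simp
  note E = this
  show ?thesis
    by (rule has_vector_derivative_transform_within_open[OF D open_greaterThan[of 0] _ E]) (use t in auto)
qed

text \<open>Green's identity with \<open>\<psi> = gauss * \<eta>\<close> moves the Laplacian from the kernel
to \<open>\<phi>\<close>, where the eigenvalue equation applies; the price is the commutator term.\<close>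

lemma source_eq:
  assumes t: "t > 0"
  shows "(\<integral>w. (\<Sum>i\<in>UNIV. gauss_d2 i t P w) * of_real (localized w) \<partial>lborel) = - of_real (lam\<^sup>2) * heat t P - source t P"
proof -
  let ?\<psi> = "\<lambda>w. gauss t P w * complex_of_real (\<eta> (w - x0))"
  let ?\<psi>1 = "\<lambda>i w. gauss t P w * complex_of_real (\<eta>1 i (w - x0)) + gauss_d1 i t P w * complex_of_real (\<eta> (w - x0))"
  let ?\<psi>2 = "\<lambda>i w. (gauss t P w * complex_of_real (\<eta>2 i (w - x0)) + gauss_d1 i t P w * complex_of_real (\<eta>1 i (w - x0)))
      + (gauss_d1 i t P w * complex_of_real (\<eta>1 i (w - x0)) + gauss_d2 i t P w * complex_of_real (\<eta> (w - x0)))"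
  have t0: "t \<noteq> 0" using t by simp
  have p: "has_partial i (\<lambda>w. complex_of_real (\<eta> (w - x0))) (\<lambda>w. complex_of_real (\<eta>1 i (w - x0)))"
     "has_partial i (\<lambda>w. complex_of_real (\<eta>1 i (w - x0))) (\<lambda>w. complex_of_real (\<eta>2 i (w - x0)))" for i
    using cut by (auto simp: cutoff_def intro!: has_partial_of_real has_partial_shift)
  have c: "continuous_on UNIV ?\<psi>" "continuous_on UNIV (?\<psi>1 i)" "continuous_on UNIV (?\<psi>2 i)" for i
    by (intro continuous_on_add continuous_on_mult continuous_on_of_real continuous_on_cutoff continuous_on_gauss_space t)+
  have d: "has_partial i ?\<psi> (?\<psi>1 i)" "has_partial i (?\<psi>1 i) (?\<psi>2 i)" for i
    by (intro has_partial_add has_partial_mult p has_partial_gauss has_partial_gauss_d1 t0)+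
  have G: "(\<integral>x. of_real (\<phi> x) * (\<Sum>i\<in>UNIV. ?\<psi>2 i x) \<partial>lborel) = (\<integral>x. of_real (laplacian \<phi> x) * ?\<psi> x \<partial>lborel)"
    by (rule Green_identity_compact_support[OF O \<phi> d c]) (simp_all add: cutoff_outside)
  have "(\<lambda>x. of_real (laplacian \<phi> x) * ?\<psi> x) = (\<lambda>x. - of_real (lam\<^sup>2) * (gauss t P x * of_real (localized x)))"
  proof
    fix x
    show "of_real (laplacian \<phi> x) * ?\<psi> x = - of_real (lam\<^sup>2) * (gauss t P x * of_real (localized x))"
    proof (cases "x \<in> \<Omega>")
      case True
      have "laplacian \<phi> x = - (lam\<^sup>2 * \<phi> x)" using eig[OF True] by linarith
      then show ?thesis by (simp add: localized_def)
    next
      case False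
      then have "x \<notin> cball x0 R" using O by blast
      then show ?thesis by (simp add: localized_def cutoff_outside)
    qed
  qed
  then have r: "(\<integral>x. of_real (laplacian \<phi> x) * ?\<psi> x \<partial>lborel) = - of_real (lam\<^sup>2) * heat t P"
    unfolding heat_def by simp
  have l: "of_real (\<phi> x) * (\<Sum>i\<in>UNIV. ?\<psi>2 i x) = (\<Sum>i\<in>UNIV. gauss_d2 i t P x) * of_real (localized x) + of_real (\<phi> x) * commutator t P x" for x
    by (simp add: localized_def commutator_def sum.distrib sum_distrib_left sum_distrib_right algebra_simps)
  have int: "integrable lborel (\<lambda>w. (\<Sum>i\<in>UNIV. gauss_d2 i t P w) * of_real (localized w))"
    by (intro integrable_localized continuous_on_sum continuous_on_gauss_space t)
  have "continuous_on UNIV (\<lambda>w. of_real (\<phi> w) * commutator t P w)"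
  proof (rule continuous_on_UNIV_of_cball_support[OF O])
    show "continuous_on \<Omega> (\<lambda>w. of_real (\<phi> w) * commutator t P w)" unfolding commutator_def
      by (intro continuous_on_sum continuous_on_mult continuous_on_add continuous_on_of_real continuous_on_const
          continuous_on_phi continuous_on_cutoff continuous_on_gauss_space t)
  qed (simp add: commutator_def cutoff_outside)
  then have "integrable lborel (\<lambda>w. of_real (\<phi> w) * commutator t P w)"
    by (rule integrable_continuous_cball_support[where R=R and ?x0.0=x0]) (simp add: commutator_def cutoff_outside)
  with int have "(\<integral>x. of_real (\<phi> x) * (\<Sum>i\<in>UNIV. ?\<psi>2 i x) \<partial>lborel) =
      (\<integral>w. (\<Sum>i\<in>UNIV. gauss_d2 i t P w) * of_real (localized w) \<partial>lborel) + source t P"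
    unfolding l source_def by (rule Bochner_Integration.integral_add)
  with G r show ?thesis by (simp add: algebra_simps)
qed

text \<open>After multiplication by \<open>exp (lam\<^sup>2 * t)\<close> the eigenvalue term cancels. If there
were no cutoff, the renormalized heat evolution would not depend on \<open>t\<close> at all; with
it, only the commutator contributes.\<close>

lemma renormalized_heat_has_vector_derivative:
  assumes t: "t > 0"
  shows "((\<lambda>t. of_real (exp (lam\<^sup>2 * t)) * heat t P) has_vector_derivative - of_real (exp (lam\<^sup>2 * t)) * source t P) (at t)"
proof -
  have "((\<lambda>t. exp (lam\<^sup>2 * t)) has_real_derivative exp (lam\<^sup>2 * t) * lam\<^sup>2) (at t)"
    by (auto intro!: derivative_eq_intros)
  then have e: "((\<lambda>t. complex_of_real (exp (lam\<^sup>2 * t))) has_vector_derivative of_real (exp (lam\<^sup>2 * t) * lam\<^sup>2)) (at t)"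
    by (rule has_vector_derivative_of_real)
  have "E * (- l * H - S) + E * l * H = - E * S" for E l H S :: complex
    by (simp add: algebra_simps)
  then show ?thesis
    using has_vector_derivative_mult[OF e heat_has_vector_derivative[OF t, of P]]
    unfolding source_eq[OF t] of_real_mult by metis
qed

end

section \<open>Bounds for the evolution at complex points\<close>

lemma Re_sq_dist: "Re (sq_dist P w) = (\<Sum>i\<in>UNIV. (Re (P $ i) - w $ i)\<^sup>2) - (\<Sum>i\<in>UNIV. (Im (P $ i))\<^sup>2)"
  by (simp add: sq_dist_def sum_subtractf[symmetric] power2_eq_square)

lemma norm_gauss:
  assumes "t > 0"
  shows "norm (gauss t P w) = exp (- Re (sq_dist P w) / (4 * t)) / t"
proof -
  have "Re (- sq_dist P w / (4 * complex_of_real t)) = - Re (sq_dist P w) / (4 * t)"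
    using Re_divide_of_real[of "- sq_dist P w" "4 * t"] by simp
  then show ?thesis using assms by (simp add: gauss_def norm_divide)
qed

text \<open>The Gaussian factors over the coordinates, and each factor is a multiple of a normal density with
variance 1/2.\<close>

lemma integrable_exp_norm_sq: "integrable lborel (\<lambda>y::'a::euclidean_space. exp (- (norm y)\<^sup>2))"
proof (rule integrableI_nonneg)
  let ?g = "\<lambda>x::real. ennreal (exp (- x\<^sup>2))"
  have nd: "normal_density 0 (1 / sqrt 2) x = 1 / sqrt pi * exp (- x\<^sup>2)" for x
    by (simp add: normal_density_def power_divide)
  have "integrable lborel (\<lambda>x. sqrt pi * normal_density 0 (1 / sqrt 2) x)"
    by (intro integrable_mult_right integrable_normal_density) simp
  then have "integrable lborel (\<lambda>x::real. exp (- x\<^sup>2))" by (simp add: nd)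
  then have 1: "(\<integral>\<^sup>+x. ?g x \<partial>lborel) < \<infinity>"
    by (subst (asm) integrable_iff_bounded) simp
  have "ennreal (exp (- (norm y)\<^sup>2)) = (\<Prod>b\<in>Basis. ?g (y \<bullet> b))" for y :: 'a
  proof -
    have "(norm y)\<^sup>2 = (\<Sum>b\<in>Basis. (y \<bullet> b)\<^sup>2)"
      unfolding power2_norm_eq_inner by (subst euclidean_inner) (simp add: power2_eq_square)
    then have "exp (- (norm y)\<^sup>2) = (\<Prod>b\<in>Basis. exp (- (y \<bullet> b)\<^sup>2))"
      by (simp add: exp_sum[symmetric] sum_negf)
    then show ?thesis by (simp add: prod_ennreal)
  qed
  then have "(\<integral>\<^sup>+y. ennreal (exp (- (norm y)\<^sup>2)) \<partial>(lborel :: 'a measure)) = (\<Prod>b\<in>(Basis :: 'a set). (\<integral>\<^sup>+x. ?g x \<partial>lborel))"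
    using nn_integral_lborel_prod[of "\<lambda>b::'a. ?g"] by simp
  also have "\<dots> < \<infinity>" using 1 by (simp add: power_less_top_ennreal)
  finally show "(\<integral>\<^sup>+y. ennreal (exp (- (norm y)\<^sup>2)) \<partial>(lborel :: 'a measure)) < \<infinity>" .
qed auto

lemma integral_exp_norm_sq_pos: "(\<integral>y. exp (- (norm y)\<^sup>2) \<partial>(lborel :: 'a::euclidean_space measure)) > 0"
proof -
  have "(\<integral>y. exp (- (norm y)\<^sup>2) \<partial>(lborel :: 'a measure)) \<noteq> 0"
  proof
    assume "(\<integral>y. exp (- (norm y)\<^sup>2) \<partial>(lborel :: 'a measure)) = 0"
    then have "AE y in (lborel :: 'a measure). exp (- (norm y)\<^sup>2) = 0"
      by (subst (asm) integral_nonneg_eq_0_iff_AE[OF integrable_exp_norm_sq]) auto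
    then have "ae_filter (lborel :: 'a measure) = bot" by (simp add: eventually_False)
    then show False by (simp add: ae_filter_eq_bot_iff)
  qed
  moreover have "(\<integral>y. exp (- (norm y)\<^sup>2) \<partial>(lborel :: 'a measure)) \<ge> 0" by (intro integral_nonneg_AE) auto
  ultimately show ?thesis by linarith
qed

lemma lborel_integral_affine:
  fixes f :: "'a::euclidean_space \<Rightarrow> real"
  assumes [measurable]: "f \<in> borel_measurable borel" and c: "c \<noteq> 0"
  shows "(\<integral>w. f w \<partial>lborel) = \<bar>c\<bar> ^ DIM('a) * (\<integral>y. f (x + c *\<^sub>R y) \<partial>lborel)"
proof -
  have "(\<integral>w. f w \<partial>lborel) = (\<integral>w. f w \<partial>density (distr lborel borel (\<lambda>y. x + c *\<^sub>R y)) (\<lambda>_. ennreal (\<bar>c\<bar> ^ DIM('a))))"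
    using lborel_affine[OF c, of x] by simp
  also have "\<dots> = (\<integral>w. \<bar>c\<bar> ^ DIM('a) *\<^sub>R f w \<partial>distr lborel borel (\<lambda>y. x + c *\<^sub>R y))"
    by (intro integral_density) auto
  also have "\<dots> = (\<integral>y. \<bar>c\<bar> ^ DIM('a) *\<^sub>R f (x + c *\<^sub>R y) \<partial>lborel)"
    by (intro integral_distr) auto
  finally show ?thesis by simp
qed

lemma exp_neg_div_le:
  fixes \<kappa> t :: real
  assumes "\<kappa> > 0" "t > 0"
  shows "exp (- \<kappa> / t) / t \<le> 1 / \<kappa>" "exp (- \<kappa> / t) / t\<^sup>2 \<le> 2 / \<kappa>\<^sup>2"
proof -
  have q: "1 + \<kappa>/t + (\<kappa>/t)\<^sup>2 / 2 \<le> exp (\<kappa>/t)"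
    using assms by (intro exp_lower_Taylor_quadratic) simp
  have a: "\<kappa>/t \<le> exp (\<kappa>/t)" "(\<kappa>/t)\<^sup>2 / 2 \<le> exp (\<kappa>/t)"
  proof -
    have "0 \<le> \<kappa>/t" "0 \<le> (\<kappa>/t)\<^sup>2" using assms by auto
    then show "\<kappa>/t \<le> exp (\<kappa>/t)" "(\<kappa>/t)\<^sup>2 / 2 \<le> exp (\<kappa>/t)" using q by linarith+
  qed
  have m: "exp (- \<kappa> / t) = 1 / exp (\<kappa>/t)" by (simp add: exp_minus divide_inverse)
  show "exp (- \<kappa> / t) / t \<le> 1 / \<kappa>" using a(1) assms unfolding m by (simp add: field_simps)
  show "exp (- \<kappa> / t) / t\<^sup>2 \<le> 2 / \<kappa>\<^sup>2" using a(2) assms unfolding m by (simp add: field_simps)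
qed

definition complex_vec :: "real^2 \<Rightarrow> complex^2" where "complex_vec x = (\<chi> i. of_real (x $ i))"

lemma sq_dist_complex_vec: "sq_dist (complex_vec x) w = of_real ((norm (x - w))\<^sup>2)"
proof -
  have "(norm (x - w))\<^sup>2 = (\<Sum>i\<in>UNIV. (x $ i - w $ i)\<^sup>2)"
    unfolding power2_norm_eq_inner inner_vec_def by (simp add: power2_eq_square)
  then show ?thesis by (simp add: sq_dist_def complex_vec_def)
qed

text \<open>Complex points so close to \<open>x0\<close> that, for \<open>w\<close> at distance at least
\<open>R / 2\<close> from \<open>x0\<close>, the real part of \<open>sq_dist P w\<close> is
bounded below by a positive multiple of \<open>R\<^sup>2\<close>.\<close>

definition near :: "real^2 \<Rightarrow> real \<Rightarrow> complex^2 \<Rightarrow> bool" where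
  "near x0 R P \<longleftrightarrow> (\<forall>i. \<bar>Re (P $ i) - x0 $ i\<bar> \<le> R / 8 \<and> \<bar>Im (P $ i)\<bar> \<le> R / 16)"

definition commutator_const :: "real \<Rightarrow> real \<Rightarrow> real" where
  "commutator_const R A = 2 * A * (4 * R / (R\<^sup>2 / 128)\<^sup>2 + 1 / (R\<^sup>2 / 128))"

lemma commutator_const_pos: "R > 0 \<Longrightarrow> A > 0 \<Longrightarrow> commutator_const R A > 0"
  by (simp add: commutator_const_def add_pos_pos)

text \<open>The integral of the kernel at any time, obtained by the substitution \<open>w = x + 2 * sqrt t *
y\<close>.\<close>

definition gauss_mass :: real where
  "gauss_mass = 4 * (\<integral>y. exp (- (norm y)\<^sup>2) \<partial>(lborel :: (real^2) measure))"

lemma gauss_mass_pos: "gauss_mass > 0"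
  using integral_exp_norm_sq_pos[where 'a="real^2"] by (simp add: gauss_mass_def)

context localized_eigenfunction begin

lemma near_sum_Im: "near x0 R P \<Longrightarrow> (\<Sum>i\<in>UNIV. (Im (P $ i))\<^sup>2) \<le> R\<^sup>2 / 128"
proof -
  assume n: "near x0 R P"
  have "(Im (P $ i))\<^sup>2 \<le> (R/16)\<^sup>2" for i
    using n R by (intro power2_le_iff_abs_le[THEN iffD2]) (auto simp: near_def)
  then have "(\<Sum>i\<in>UNIV. (Im (P $ i))\<^sup>2) \<le> (\<Sum>i\<in>(UNIV::2 set). (R/16)\<^sup>2)" by (intro sum_mono) auto
  then show ?thesis by (simp add: power_divide)
qed

lemma near_Re_sq_dist_ge: "near x0 R P \<Longrightarrow> Re (sq_dist P w) \<ge> - R\<^sup>2"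
proof -
  assume n: "near x0 R P"
  have "(\<Sum>i\<in>UNIV. (Re (P $ i) - w $ i)\<^sup>2) \<ge> 0" by (intro sum_nonneg) auto
  then show ?thesis using near_sum_Im[OF n] zero_le_power2[of R] unfolding Re_sq_dist by linarith
qed

lemma near_Re_sq_dist_off_ball:
  assumes n: "near x0 R P" and w: "norm (w - x0) \<ge> R / 2"
  shows "Re (sq_dist P w) \<ge> R\<^sup>2 / 32"
proof -
  define p :: "real^2" where "p = (\<chi> i. Re (P $ i))"
  have "norm (p - x0) \<le> (\<Sum>i\<in>UNIV. \<bar>(p - x0) $ i\<bar>)" by (rule norm_le_l1_cart)
  also have "\<dots> \<le> (\<Sum>i\<in>(UNIV::2 set). R / 8)" using n by (intro sum_mono) (auto simp: near_def p_def)
  finally have "norm (p - x0) \<le> R / 4" by simp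
  then have "norm (p - w) \<ge> R / 4"
    using w norm_triangle_sub[of "w - x0" "p - x0"] by (simp add: norm_minus_commute)
  then have "(norm (p - w))\<^sup>2 \<ge> (R / 4)\<^sup>2" using R by (intro power_mono) auto
  moreover have "(norm (p - w))\<^sup>2 = (\<Sum>i\<in>UNIV. (Re (P $ i) - w $ i)\<^sup>2)"
    unfolding power2_norm_eq_inner inner_vec_def by (simp add: power2_eq_square p_def)
  moreover have "(R / 4)\<^sup>2 = R\<^sup>2 / 16" by (simp add: power_divide)
  ultimately show ?thesis using near_sum_Im[OF n] zero_le_power2[of R]
    unfolding Re_sq_dist by linarith
qed

lemma near_diff:
  fixes w :: "real^2" and P :: "complex^2"
  assumes n: "near x0 R P" and w: "w \<in> cball x0 R"
  shows "norm (P $ i - of_real (w $ i)) \<le> 2 * R"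
proof -
  have "\<bar>(x0 - w) $ i\<bar> \<le> norm (x0 - w)" by (rule component_le_norm_cart)
  then have "\<bar>x0 $ i - w $ i\<bar> \<le> R" using w by (simp add: dist_norm)
  moreover have "\<bar>Re (P $ i) - x0 $ i\<bar> \<le> R / 8" "\<bar>Im (P $ i)\<bar> \<le> R / 16" using n by (auto simp: near_def)
  moreover have "norm (P $ i - of_real (w $ i)) \<le> \<bar>Re (P $ i - of_real (w $ i))\<bar> + \<bar>Im (P $ i - of_real (w $ i))\<bar>"
    by (rule cmod_le)
  moreover have "Re (P $ i - of_real (w $ i)) = Re (P $ i) - w $ i" "Im (P $ i - of_real (w $ i)) = Im (P $ i)" by simp_all
  moreover have "\<bar>Re (P $ i) - w $ i\<bar> \<le> \<bar>Re (P $ i) - x0 $ i\<bar> + \<bar>x0 $ i - w $ i\<bar>" by linarith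
  ultimately show ?thesis using R by linarith
qed

definition phi_mass where "phi_mass = (\<integral>w. indicator (cball x0 R) w * \<bar>\<phi> w\<bar> \<partial>lborel)"

text \<open>Where the cutoff varies the kernel is at most \<open>exp (- kap / t) / t\<close> with a
multiple \<open>kap\<close> of \<open>R\<^sup>2\<close>, which absorbs
every negative power of \<open>t\<close> produced by the derivatives. The bound is therefore
uniform in \<open>t\<close>, in \<open>P\<close> and in the eigenvalue.\<close>

lemma commutator_bound:
  assumes n: "near x0 R P" and t: "t > 0" and w: "w \<in> cball x0 R"
  shows "norm (commutator t P w) \<le> commutator_const R A"
proof (cases "norm (w - x0) \<le> R / 2")
  case True
  then have "commutator t P w = 0" using cut by (simp add: commutator_def cutoff_def)
  then show ?thesis using commutator_const_pos[OF R A] by simp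
next
  case False
  define kap where "kap = R\<^sup>2 / 128"
  have kap: "kap > 0" using R by (simp add: kap_def)
  have g: "norm (gauss t P w) \<le> exp (- kap / t) / t"
    using near_Re_sq_dist_off_ball[OF n, of w] False t
    by (auto simp: norm_gauss kap_def divide_right_mono field_simps)
  have cb: "\<bar>\<eta>1 i (w - x0)\<bar> \<le> A" "\<bar>\<eta>2 i (w - x0)\<bar> \<le> A" for i using cut by (auto simp: cutoff_def)
  have "norm (2 * gauss_d1 i t P w * of_real (\<eta>1 i (w - x0)) + gauss t P w * of_real (\<eta>2 i (w - x0)))
     \<le> A * (4 * R / kap\<^sup>2 + 1 / kap)" for i
  proof -
    have "norm (2 * gauss_d1 i t P w * of_real (\<eta>1 i (w - x0)) + gauss t P w * of_real (\<eta>2 i (w - x0)))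
      \<le> norm (2 * gauss_d1 i t P w * of_real (\<eta>1 i (w - x0))) + norm (gauss t P w * of_real (\<eta>2 i (w - x0)))"
      by (rule norm_triangle_ineq)
    also have "\<dots> = norm (gauss t P w) * (norm (P $ i - of_real (w $ i)) / t) * \<bar>\<eta>1 i (w - x0)\<bar> + norm (gauss t P w) * \<bar>\<eta>2 i (w - x0)\<bar>"
      using t by (simp add: gauss_d1_def norm_mult norm_divide)
    also have "\<dots> \<le> (exp (- kap / t) / t) * (2 * R / t) * A + (exp (- kap / t) / t) * A"
      using g cb near_diff[OF n w, of i] t R
      by (intro add_mono mult_mono divide_right_mono) auto
    also have "\<dots> = A * (2 * R * (exp (- kap / t) / t\<^sup>2) + exp (- kap / t) / t)"
      by (simp add: power2_eq_square algebra_simps)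
    also have "\<dots> \<le> A * (2 * R * (2 / kap\<^sup>2) + 1 / kap)"
      using exp_neg_div_le[OF kap t] A R by (intro mult_left_mono add_mono) auto
    finally show ?thesis by simp
  qed
  then have "norm (commutator t P w) \<le> (\<Sum>i\<in>(UNIV::2 set). A * (4 * R / kap\<^sup>2 + 1 / kap))"
    unfolding commutator_def by (intro order_trans[OF norm_sum] sum_mono)
  then show ?thesis by (simp add: commutator_const_def kap_def)
qed

lemma phi_mass_integrable: "integrable lborel (\<lambda>w. indicator (cball x0 R) w * \<bar>\<phi> w\<bar>)"
proof -
  have "continuous_on (cball x0 R) (\<lambda>w. \<bar>\<phi> w\<bar>)"
    by (rule continuous_on_rabs[OF continuous_on_subset[OF continuous_on_phi O(2)]])
  then have "integrable lborel (\<lambda>w. indicator (cball x0 R) w *\<^sub>R \<bar>\<phi> w\<bar>)"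
    by (rule borel_integrable_compact[OF compact_cball])
  then show ?thesis by simp
qed

lemma phi_mass_nonneg: "phi_mass \<ge> 0"
  unfolding phi_mass_def by (intro integral_nonneg_AE) auto

lemma integral_phi_bound:
  assumes "\<And>w. w \<in> cball x0 R \<Longrightarrow> norm (E w) \<le> B" "\<And>w. w \<notin> cball x0 R \<Longrightarrow> E w = (0::complex)" "B \<ge> 0"
  shows "norm (\<integral>w. of_real (\<phi> w) * E w \<partial>lborel) \<le> B * phi_mass"
proof -
  have "norm (\<integral>w. of_real (\<phi> w) * E w \<partial>lborel) \<le> (\<integral>w. norm (of_real (\<phi> w) * E w) \<partial>lborel)"
    by (rule integral_norm_bound)
  also have "\<dots> \<le> (\<integral>w. B * (indicator (cball x0 R) w * \<bar>\<phi> w\<bar>) \<partial>lborel)"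
  proof (rule integral_mono')
    show "integrable lborel (\<lambda>w. B * (indicator (cball x0 R) w * \<bar>\<phi> w\<bar>))"
      using phi_mass_integrable by simp
    show "norm (of_real (\<phi> w) * E w) \<le> B * (indicator (cball x0 R) w * \<bar>\<phi> w\<bar>)" for w
    proof (cases "w \<in> cball x0 R")
      case True
      have "\<bar>\<phi> w\<bar> * norm (E w) \<le> \<bar>\<phi> w\<bar> * B" using assms(1)[OF True] by (intro mult_left_mono) auto
      then show ?thesis using True by (simp add: norm_mult mult.commute)
    qed (simp add: assms(2))
    show "0 \<le> B * (indicator (cball x0 R) w * \<bar>\<phi> w\<bar>)" for w using assms(3) by simp
  qed
  finally show ?thesis by (simp add: phi_mass_def)
qed

lemma source_bound:
  assumes n: "near x0 R P" and t: "t > 0"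
  shows "norm (source t P) \<le> commutator_const R A * phi_mass"
  unfolding source_def using commutator_bound[OF n t] commutator_const_pos[OF R A]
  by (intro integral_phi_bound) (auto simp: commutator_def cutoff_outside)

lemma heat_bound:
  assumes n: "near x0 R P" and t: "t > 0"
  shows "norm (heat t P) \<le> A * exp (R\<^sup>2 / (4 * t)) / t * phi_mass"
proof -
  have "heat t P = (\<integral>w. of_real (\<phi> w) * (gauss t P w * of_real (\<eta> (w - x0))) \<partial>lborel)"
    by (simp add: heat_def localized_def mult_ac)
  also have "norm \<dots> \<le> A * exp (R\<^sup>2 / (4 * t)) / t * phi_mass"
  proof (rule integral_phi_bound)
    fix w
    have "- Re (sq_dist P w) / (4 * t) \<le> R\<^sup>2 / (4 * t)"
      using near_Re_sq_dist_ge[OF n, of w] t by (intro divide_right_mono) auto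
    then have "norm (gauss t P w) \<le> exp (R\<^sup>2 / (4 * t)) / t"
      unfolding norm_gauss[OF t] using t by (intro divide_right_mono) auto
    moreover have "\<bar>\<eta> (w - x0)\<bar> \<le> A" using cut by (auto simp: cutoff_def)
    ultimately have "norm (gauss t P w) * \<bar>\<eta> (w - x0)\<bar> \<le> exp (R\<^sup>2 / (4 * t)) / t * A"
      using t by (intro mult_mono) auto
    then show "norm (gauss t P w * of_real (\<eta> (w - x0))) \<le> A * exp (R\<^sup>2 / (4 * t)) / t"
      by (simp add: norm_mult mult.commute)
  qed (use A t cutoff_outside in auto)
  finally show ?thesis .
qed

text \<open>At time \<open>1 / lam\<close> the kernel is only of size \<open>exp (O(lam))\<close> at complex
points, and the factor \<open>exp (lam\<^sup>2 * t)\<close> is at most \<open>exp lam\<close> for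
all earlier times. Integrating the derivative back from \<open>1 / lam\<close> to \<open>t\<close>
costs only the bounded source term.\<close>

lemma renormalized_heat_bound:
  assumes n: "near x0 R P" and t: "0 < t" "t \<le> 1 / lam" and lam: "lam > 0"
  shows "norm (of_real (exp (lam\<^sup>2 * t)) * heat t P) \<le> exp lam * (A * lam * exp (R\<^sup>2 * lam / 4) + commutator_const R A / lam) * phi_mass"
proof -
  let ?f = "\<lambda>t. of_real (exp (lam\<^sup>2 * t)) * heat t P"
  let ?T = "1 / lam"
  have T: "?T > 0" using lam by simp
  have e: "exp (lam\<^sup>2 * s) \<le> exp lam" if "s \<le> ?T" for s
  proof -
    have "lam\<^sup>2 * s \<le> lam\<^sup>2 * ?T" using that by (intro mult_left_mono) auto
    then show ?thesis using lam by (simp add: power2_eq_square)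
  qed
  have "norm (?f ?T - ?f t) \<le> (exp lam * (commutator_const R A * phi_mass)) * norm (?T - t)"
  proof (rule differentiable_bound[of "{t..?T}" ?f "\<lambda>s h. h *\<^sub>R (- of_real (exp (lam\<^sup>2 * s)) * source s P)"])
    fix s assume s: "s \<in> {t..?T}"
    then have s0: "s > 0" using t by simp
    show "(?f has_derivative (\<lambda>h. h *\<^sub>R (- of_real (exp (lam\<^sup>2 * s)) * source s P))) (at s within {t..?T})"
      using renormalized_heat_has_vector_derivative[OF s0, of P]
      unfolding has_vector_derivative_def by (rule has_derivative_at_withinI)
    have "norm (- of_real (exp (lam\<^sup>2 * s)) * source s P) \<le> exp lam * (commutator_const R A * phi_mass)"
      unfolding norm_mult using e[of s] s source_bound[OF n s0]
      by (intro mult_mono) auto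
    then show "onorm (\<lambda>h. h *\<^sub>R (- of_real (exp (lam\<^sup>2 * s)) * source s P)) \<le> exp lam * (commutator_const R A * phi_mass)"
      by (intro onorm_le) (metis abs_ge_zero mult.commute mult_left_mono norm_scaleR real_norm_def)
  qed (use t in auto)
  also have "\<dots> \<le> (exp lam * (commutator_const R A * phi_mass)) * (1 / lam)"
    using t lam commutator_const_pos[OF R A] phi_mass_nonneg by (intro mult_left_mono) auto
  finally have 1: "norm (?f ?T - ?f t) \<le> exp lam * (commutator_const R A / lam) * phi_mass" by (simp add: mult_ac)
  have "norm (heat ?T P) \<le> A * exp (R\<^sup>2 * lam / 4) * lam * phi_mass"
    using heat_bound[OF n T] by (simp add: mult_ac)
  then have 2: "norm (?f ?T) \<le> exp lam * (A * exp (R\<^sup>2 * lam / 4) * lam * phi_mass)"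
    unfolding norm_mult using e[of ?T] by (intro mult_mono) auto
  have "norm (?f t) \<le> norm (?f ?T) + norm (?f ?T - ?f t)"
    using norm_triangle_sub[of "?f t" "?f ?T"] by (simp add: norm_minus_commute)
  with 1 2 show ?thesis by (simp add: algebra_simps)
qed

end

section \<open>Growth of the holomorphic extension\<close>

context localized_eigenfunction begin

lemma localized_bounded: obtains M where "\<And>w. \<bar>localized w\<bar> \<le> M"
proof -
  have "compact (localized ` cball x0 R)"
    by (intro compact_continuous_image continuous_on_subset[OF continuous_on_localized] compact_cball) simp
  then obtain M where M: "M > 0" "\<And>w. w \<in> cball x0 R \<Longrightarrow> \<bar>localized w\<bar> \<le> M"
    using compact_imp_bounded[of "localized ` cball x0 R"] unfolding bounded_pos by auto
  have "\<bar>localized w\<bar> \<le> M" for w using M localized_outside[of w] by (cases "w \<in> cball x0 R") auto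
  then show thesis by (rule that)
qed

lemma heat_complex_vec:
  assumes t: "t > 0"
  shows "heat t (complex_vec x) = of_real (4 * (\<integral>y. exp (- (norm y)\<^sup>2) * localized (x + (2 * sqrt t) *\<^sub>R y) \<partial>lborel))"
proof -
  let ?f = "\<lambda>w. exp (- (norm (x - w))\<^sup>2 / (4 * t)) / t * localized w"
  let ?c = "2 * sqrt t"
  have "gauss t (complex_vec x) w = of_real (exp (- (norm (x - w))\<^sup>2 / (4 * t)) / t)" for w
    by (simp add: gauss_def sq_dist_complex_vec exp_of_real[symmetric])
  then have "heat t (complex_vec x) = (\<integral>w. of_real (?f w) \<partial>lborel)"
    unfolding heat_def by simp
  also have "\<dots> = of_real (\<integral>w. ?f w \<partial>lborel)" by (rule integral_complex_of_real)
  also have "(\<integral>w. ?f w \<partial>lborel) = \<bar>?c\<bar> ^ DIM(real^2) * (\<integral>y. ?f (x + ?c *\<^sub>R y) \<partial>lborel)"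
  proof (rule lborel_integral_affine)
    have "continuous_on UNIV ?f" using t by (intro continuous_intros continuous_on_localized) auto
    then show "?f \<in> borel_measurable borel" by (rule borel_measurable_continuous_onI)
  qed (use t in auto)
  also have "\<bar>?c\<bar> ^ DIM(real^2) = 4 * t" using t by (simp add: power_mult_distrib)
  also have "(\<lambda>y. ?f (x + ?c *\<^sub>R y)) = (\<lambda>y. (1 / t) * (exp (- (norm y)\<^sup>2) * localized (x + ?c *\<^sub>R y)))"
    using t by (auto simp: power_mult_distrib fun_eq_iff)
  finally show ?thesis using t by simp
qed

text \<open>At real points the heat evolution recovers the initial data times the total mass of the
kernel as the time tends to zero, by dominated convergence after rescaling.\<close>

lemma heat_tendsto:
  assumes s: "\<And>n. s n > 0" "s \<longlonglongrightarrow> 0"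
  shows "(\<lambda>n. heat (s n) (complex_vec x)) \<longlonglongrightarrow> of_real (gauss_mass * localized x)"
proof -
  obtain M where M: "\<And>w. \<bar>localized w\<bar> \<le> M" using localized_bounded by blast
  have "(\<lambda>n. \<integral>y. exp (- (norm y)\<^sup>2) * localized (x + (2 * sqrt (s n)) *\<^sub>R y) \<partial>lborel)
     \<longlonglongrightarrow> (\<integral>y. exp (- (norm (y::real^2))\<^sup>2) * localized x \<partial>lborel)"
  proof (rule integral_dominated_convergence[where w = "\<lambda>y::real^2. exp (- (norm y)\<^sup>2) * M"])
    show "(\<lambda>y::real^2. exp (- (norm y)\<^sup>2) * localized x) \<in> borel_measurable lborel" by measurable
    have "continuous_on UNIV (\<lambda>y. exp (- (norm y)\<^sup>2) * localized (x + (2 * sqrt (s n)) *\<^sub>R y))" for n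
      by (intro continuous_intros continuous_on_localized_compose)
    then show "(\<lambda>y. exp (- (norm y)\<^sup>2) * localized (x + (2 * sqrt (s n)) *\<^sub>R y)) \<in> borel_measurable lborel" for n
      using borel_measurable_continuous_onI by auto
    show "integrable lborel (\<lambda>y::real^2. exp (- (norm y)\<^sup>2) * M)"
      using integrable_exp_norm_sq by (rule integrable_mult_left)
    show "AE y in lborel. (\<lambda>n. exp (- (norm y)\<^sup>2) * localized (x + (2 * sqrt (s n)) *\<^sub>R y)) \<longlonglongrightarrow> exp (- (norm y)\<^sup>2) * localized x"
    proof (intro AE_I2)
      fix y
      have "(\<lambda>n. x + (2 * sqrt (s n)) *\<^sub>R y) \<longlonglongrightarrow> x + (2 * sqrt 0) *\<^sub>R y"
        by (intro tendsto_intros s)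
      then have "(\<lambda>n. x + (2 * sqrt (s n)) *\<^sub>R y) \<longlonglongrightarrow> x" by simp
      moreover have "isCont localized x" using continuous_on_localized by (simp add: continuous_on_eq_continuous_at)
      ultimately have "(\<lambda>n. localized (x + (2 * sqrt (s n)) *\<^sub>R y)) \<longlonglongrightarrow> localized x"
        by (rule isCont_tendsto_compose[rotated])
      then show "(\<lambda>n. exp (- (norm y)\<^sup>2) * localized (x + (2 * sqrt (s n)) *\<^sub>R y)) \<longlonglongrightarrow> exp (- (norm y)\<^sup>2) * localized x"
        by (intro tendsto_intros)
    qed
    show "AE y in lborel. norm (exp (- (norm y)\<^sup>2) * localized (x + (2 * sqrt (s n)) *\<^sub>R y)) \<le> exp (- (norm y)\<^sup>2) * M" for n
      by (intro AE_I2) (simp add: abs_mult M)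
  qed
  then have "(\<lambda>n. of_real (4 * (\<integral>y. exp (- (norm y)\<^sup>2) * localized (x + (2 * sqrt (s n)) *\<^sub>R y) \<partial>lborel)))
     \<longlonglongrightarrow> complex_of_real (4 * (\<integral>y. exp (- (norm (y::real^2))\<^sup>2) * localized x \<partial>lborel))"
    by (intro tendsto_intros)
  then show ?thesis
    unfolding heat_complex_vec[OF s(1)] gauss_mass_def integral_mult_left_zero by (simp only: mult.assoc)
qed

text \<open>Differentiation under the integral over a box that contains the support of the cutoff.\<close>

lemma heat_holomorphic:
  fixes g :: "complex \<Rightarrow> complex^2"
  assumes t: "t > 0" and U: "open U" "convex U" and g: "\<And>i. (\<lambda>\<tau>. g \<tau> $ i) holomorphic_on U"
  shows "(\<lambda>\<tau>. heat t (g \<tau>)) holomorphic_on U"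
proof -
  obtain a b where ab: "cball x0 R \<subseteq> cbox a b"
    using bounded_subset_cbox_symmetric[OF bounded_cball] by metis
  have v0: "localized w = 0" if "w \<notin> cbox a b" for w using localized_outside[of w] ab that by blast
  define dg where "dg i = deriv (\<lambda>\<tau>. g \<tau> $ i)" for i
  have dg: "((\<lambda>\<tau>. g \<tau> $ i) has_field_derivative dg i \<tau>) (at \<tau>)" if "\<tau> \<in> U" for i \<tau>
    unfolding dg_def using holomorphic_derivI[OF g U(1) that] by simp
  have dgc: "continuous_on U (dg i)" for i
    unfolding dg_def by (intro holomorphic_on_imp_continuous_on holomorphic_deriv g U)
  have gc: "continuous_on U (\<lambda>\<tau>. g \<tau> $ i)" for i using g holomorphic_on_imp_continuous_on by blast
  let ?d = "\<lambda>\<tau> w. gauss t (g \<tau>) w * (- (\<Sum>i\<in>UNIV. 2 * (g \<tau> $ i - of_real (w $ i)) * dg i \<tau>) / (4 * of_real t))"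
  have d: "((\<lambda>\<tau>. gauss t (g \<tau>) w) has_field_derivative ?d \<tau> w) (at \<tau>)" if "\<tau> \<in> U" for \<tau> w
  proof -
    have s: "((\<lambda>\<tau>. (g \<tau> $ i - of_real (w $ i))\<^sup>2) has_field_derivative 2 * (g \<tau> $ i - of_real (w $ i)) * dg i \<tau>) (at \<tau>)" for i
      using dg[OF that, of i] by (auto intro!: derivative_eq_intros)
    have "((\<lambda>\<tau>. sq_dist (g \<tau>) w) has_field_derivative (\<Sum>i\<in>UNIV. 2 * (g \<tau> $ i - of_real (w $ i)) * dg i \<tau>)) (at \<tau>)"
      unfolding sq_dist_def by (intro DERIV_sum s)
    from DERIV_cdivide[OF DERIV_chain2[OF DERIV_exp DERIV_cdivide[OF DERIV_minus[OF this], of "4 * of_real t"]], of "of_real t"]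
    show ?thesis unfolding gauss_def by (simp add: field_simps)
  qed
  have c1: "continuous_on S (\<lambda>w. complex_of_real (localized w))" for S
    by (intro continuous_on_of_real continuous_on_subset[OF continuous_on_localized]) simp
  have fst': "continuous_on (U \<times> cbox a b) (\<lambda>p. f (fst p))" if "continuous_on U f" for f :: "complex \<Rightarrow> complex"
    by (rule continuous_on_compose2[OF that]) (auto intro!: continuous_intros)
  have "(\<lambda>\<tau>. integral (cbox a b) (\<lambda>w. gauss t (g \<tau>) w * of_real (localized w))) holomorphic_on U"
  proof (rule leibniz_rule_holomorphic[where f = "\<lambda>\<tau> w. gauss t (g \<tau>) w * of_real (localized w)" and fx = "\<lambda>\<tau> w. ?d \<tau> w * of_real (localized w)"])
    show "((\<lambda>\<tau>. gauss t (g \<tau>) w * of_real (localized w)) has_field_derivative ?d \<tau> w * of_real (localized w)) (at \<tau> within U)"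
      if "\<tau> \<in> U" for \<tau> w
      using has_field_derivative_at_within[OF DERIV_cmult_right[OF d[OF that]]] .
    show "(\<lambda>w. gauss t (g \<tau>) w * of_real (localized w)) integrable_on cbox a b" for \<tau>
      by (intro integrable_continuous continuous_on_mult continuous_on_gauss_space(1)[OF t] c1)
    have c: "continuous_on (U \<times> cbox a b) (\<lambda>p. gauss t (g (fst p)) (snd p))"
      using t by (intro continuous_on_gauss fst'[OF gc] continuous_on_const continuous_on_snd continuous_on_id) auto
    have c3: "continuous_on (U \<times> cbox a b) (\<lambda>p::complex \<times> _. complex_of_real (localized (snd p)))"
      by (intro continuous_on_of_real continuous_on_compose2[OF continuous_on_localized] continuous_on_snd continuous_on_id) simp
    have c4: "continuous_on (U \<times> cbox a b) (\<lambda>p::complex \<times> (real^2). complex_of_real (snd p $ i))" for i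
      by (intro continuous_intros)
    show "continuous_on (U \<times> cbox a b) (\<lambda>(\<tau>, w). ?d \<tau> w * of_real (localized w))"
      unfolding split_beta using t
      by (intro continuous_on_mult c c3 c4 fst'[OF gc] fst'[OF dgc] continuous_on_minus continuous_on_sum
          continuous_on_diff continuous_on_divide continuous_on_const) auto
  qed (use U in auto)
  moreover have "integral (cbox a b) (\<lambda>w. gauss t (g \<tau>) w * of_real (localized w)) = heat t (g \<tau>)" for \<tau>
    unfolding heat_def
    using lborel_integral_eq_integral_cbox[OF integrable_localized[OF continuous_on_gauss_space(1)[OF t]], of a b "g \<tau>"] v0 by simp
  ultimately show ?thesis by simp
qed

text \<open>The growth estimate for the holomorphic extension \<open>h\<close> of \<open>\<phi>\<close> along
a complexified curve \<open>g\<close>. The renormalized heat evolutions along \<open>g\<close> are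
holomorphic with a common bound, so they form a normal family; a limit for times tending to zero
agrees with \<open>\<phi>\<close> at the real points of the curve and hence with \<open>h\<close>
everywhere. The bound passes to the limit.\<close>

lemma holomorphic_extension_bound:
  fixes g :: "complex \<Rightarrow> complex^2"
  assumes lam: "lam > 0" and U: "open U" "convex U" and g: "\<And>i. (\<lambda>\<tau>. g \<tau> $ i) holomorphic_on U"
    and near_g: "\<And>\<tau>. \<tau> \<in> U \<Longrightarrow> near x0 R (g \<tau>)" and h: "h holomorphic_on U"
    and T: "T \<subseteq> U" "\<xi> \<in> U" "\<xi> islimpt T"
    and real: "\<And>\<tau>. \<tau> \<in> T \<Longrightarrow> \<exists>x. g \<tau> = complex_vec x \<and> norm (x - x0) \<le> R / 2 \<and> h \<tau> = of_real (\<phi> x)"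
    and \<tau>: "\<tau> \<in> U"
  shows "norm (h \<tau>) \<le> exp lam * (A * lam * exp (R\<^sup>2 * lam / 4) + commutator_const R A / lam) * phi_mass / gauss_mass"
proof -
  let ?B = "exp lam * (A * lam * exp (R\<^sup>2 * lam / 4) + commutator_const R A / lam) * phi_mass / gauss_mass"
  \<comment> \<open>Times tending to 0 below \<open>1 / lam\<close>, where the uniform bound is available.\<close>
  define s where "s n = 1 / (lam * real (Suc n))" for n
  have s0: "s n > 0" "s n \<le> 1 / lam" for n using lam by (auto simp: s_def divide_simps)
  have s: "s \<longlonglongrightarrow> 0"
  proof -
    have "(\<lambda>n. (1 / lam) * inverse (real (Suc n))) \<longlonglongrightarrow> (1 / lam) * 0"
      by (intro tendsto_intros LIMSEQ_inverse_real_of_nat)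
    then show ?thesis by (simp add: s_def[abs_def] divide_inverse mult_ac)
  qed
  define F where "F n \<tau> = of_real (exp (lam\<^sup>2 * s n)) * heat (s n) (g \<tau>) / of_real gauss_mass" for n \<tau>
  have Fb: "norm (F n \<tau>) \<le> ?B" if "\<tau> \<in> U" for n \<tau>
    using renormalized_heat_bound[OF near_g[OF that] s0 lam] gauss_mass_pos
    by (simp add: F_def norm_divide norm_mult divide_right_mono)
  have Fh: "F n holomorphic_on U" for n
    unfolding F_def using gauss_mass_pos by (intro holomorphic_intros heat_holomorphic s0 U g) auto
  define \<H> where "\<H> = {f. f holomorphic_on U \<and> (\<forall>\<tau>\<in>U. norm (f \<tau>) \<le> ?B)}"
  obtain k r where k: "k holomorphic_on U" "strict_mono (r :: nat \<Rightarrow> nat)"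
      "\<And>x. x \<in> U \<Longrightarrow> (\<lambda>n. F (r n) x) \<longlonglongrightarrow> k x"
  proof (rule Montel[of U \<H> F])
    show "\<exists>B. \<forall>h\<in>\<H>. \<forall>z\<in>K. norm (h z) \<le> B" if "compact K" "K \<subseteq> U" for K
      using that by (intro exI[of _ ?B]) (auto simp: \<H>_def)
    show "range F \<subseteq> \<H>" using Fh Fb by (auto simp: \<H>_def)
  qed (auto simp: U \<H>_def)
  have kh: "k \<tau> - h \<tau> = 0" if "\<tau> \<in> T" for \<tau>
  proof -
    obtain x where x: "g \<tau> = complex_vec x" "norm (x - x0) \<le> R / 2" "h \<tau> = of_real (\<phi> x)" using real \<open>\<tau> \<in> T\<close> by blast
    have vx: "localized x = \<phi> x" using cut x(2) by (simp add: localized_def cutoff_def)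
    have "(\<lambda>n. F n \<tau>) \<longlonglongrightarrow> of_real (exp (lam\<^sup>2 * 0)) * of_real (gauss_mass * localized x) / of_real gauss_mass"
      unfolding F_def x(1) using gauss_mass_pos by (intro tendsto_intros heat_tendsto s0 s) auto
    then have "(\<lambda>n. F n \<tau>) \<longlonglongrightarrow> h \<tau>" using gauss_mass_pos by (simp add: vx x(3))
    then have "(\<lambda>n. F (r n) \<tau>) \<longlonglongrightarrow> h \<tau>"
      using LIMSEQ_subseq_LIMSEQ[OF _ k(2)] by (auto simp: o_def)
    moreover have "\<tau> \<in> U" using T(1) \<open>\<tau> \<in> T\<close> by blast
    ultimately have "k \<tau> = h \<tau>" using LIMSEQ_unique[OF k(3)] by blast
    then show ?thesis by simp
  qed
  have "k \<tau> - h \<tau> = 0"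
    using analytic_continuation[OF holomorphic_on_diff[OF k(1) h] U(1) convex_connected[OF U(2)] T kh \<tau>] .
  then have "(\<lambda>n. F (r n) \<tau>) \<longlonglongrightarrow> h \<tau>" using k(3)[OF \<tau>] by simp
  then have "(\<lambda>n. norm (F (r n) \<tau>)) \<longlonglongrightarrow> norm (h \<tau>)" by (rule tendsto_norm)
  then show ?thesis by (rule LIMSEQ_le_const2) (use Fb \<tau> in auto)
qed

end

text \<open>From \<open>2 * \<bar>\<phi>\<bar> \<le> 1 + \<phi>\<^sup>2\<close> and the normalization; a bound
independent of the eigenvalue and of \<open>x0\<close>.\<close>

lemma (in localized_eigenfunction) phi_mass_le:
  assumes "bounded \<Omega>" "set_lebesgue_integral lborel \<Omega> (\<lambda>x. (\<phi> x)\<^sup>2) = 1"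
  shows "phi_mass \<le> (measure lborel \<Omega> + 1) / 2"
proof -
  have m: "emeasure lborel \<Omega> < \<infinity>" using assms(1) by (rule emeasure_bounded_finite)
  have 1: "integrable lborel (\<lambda>x. indicator \<Omega> x *\<^sub>R (\<phi> x)\<^sup>2)"
    \<comment> \<open>A function that is not integrable would have integral 0.\<close>
    using assms(2) not_integrable_integral_eq unfolding set_lebesgue_integral_def by fastforce
  have 2: "integrable lborel (indicator \<Omega> :: _ \<Rightarrow> real)"
    using m O(1) by (intro integrable_real_indicator) auto
  have "phi_mass \<le> (\<integral>x. (indicator \<Omega> x + indicator \<Omega> x *\<^sub>R (\<phi> x)\<^sup>2) / 2 \<partial>lborel)"
    unfolding phi_mass_def
  proof (rule integral_mono[OF phi_mass_integrable])
    show "integrable lborel (\<lambda>x. (indicator \<Omega> x + indicator \<Omega> x *\<^sub>R (\<phi> x)\<^sup>2) / 2)"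
      using 1 2 by simp
    fix x
    have "2 * \<bar>\<phi> x\<bar> \<le> 1 + (\<phi> x)\<^sup>2"
      using zero_le_power2[of "\<bar>\<phi> x\<bar> - 1"] by (simp add: power2_diff)
    then show "indicator (cball x0 R) x * \<bar>\<phi> x\<bar> \<le> (indicator \<Omega> x + indicator \<Omega> x *\<^sub>R (\<phi> x)\<^sup>2) / 2"
      using O(2) by (auto simp: indicator_def)
  qed
  also have "\<dots> = (measure lborel \<Omega> + 1) / 2"
    using 1 2 assms(2) O(1) by (simp add: set_lebesgue_integral_def)
  finally show ?thesis .
qed

section \<open>Linear growth of the intersection number\<close>

text \<open>All factors are absorbed into one exponential: \<open>lam \<le> exp lam\<close>, \<open>1 / lam
\<le> 1 / lam0\<close>, and a constant \<open>D\<close> is at most \<open>exp (D * lam /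
lam0)\<close>.\<close>

lemma growth_constant_le_exp:
  fixes lam lam0 A B R V :: real
  assumes "lam0 > 0" "lam \<ge> lam0" "A > 0" "B > 0" "V \<ge> 0"
  shows "exp lam * (A * lam * exp (R\<^sup>2 * lam / 4) + B / lam) * V
    \<le> exp ((2 + R\<^sup>2 / 4 + V * (A + B / lam0) / lam0) * lam)"
proof -
  have lam: "lam > 0" using assms by simp
  define E where "E = exp (R\<^sup>2 * lam / 4)"
  have E: "E \<ge> 1" using lam by (simp add: E_def)
  have ll: "lam \<le> exp lam" using exp_ge_add_one_self[of lam] by linarith
  have l1: "exp lam \<ge> 1" using lam by simp
  have "A * lam * E \<le> A * (exp lam * E)"
    unfolding mult.assoc using ll E assms by (intro mult_left_mono mult_right_mono) auto
  moreover have "B / lam \<le> B / lam0" using assms by (intro divide_left_mono) auto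
  moreover have "B / lam0 * 1 \<le> B / lam0 * (exp lam * E)"
    using assms l1 E mult_mono[OF l1 E] by (intro mult_left_mono) auto
  ultimately have "A * lam * E + B / lam \<le> (A + B / lam0) * (exp lam * E)"
    unfolding distrib_right by linarith
  then have "exp lam * (A * lam * E + B / lam) * V \<le> exp lam * ((A + B / lam0) * (exp lam * E)) * V"
    using assms by (intro mult_left_mono mult_right_mono) auto
  also have "\<dots> = (exp lam * exp lam * E) * (V * (A + B / lam0))" by (simp add: mult_ac)
  also have "V * (A + B / lam0) \<le> exp (V * (A + B / lam0) / lam0 * lam)"
  proof -
    let ?D = "V * (A + B / lam0)"
    have "0 \<le> ?D" using assms by simp
    then have "?D / lam0 * lam0 \<le> ?D / lam0 * lam" using assms by (intro mult_left_mono) auto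
    then have "?D \<le> ?D / lam0 * lam" using assms by simp
    then show ?thesis using exp_ge_add_one_self[of "?D / lam0 * lam"] by linarith
  qed
  also have "exp lam * exp lam * E * exp (V * (A + B / lam0) / lam0 * lam)
     = exp ((2 + R\<^sup>2 / 4 + V * (A + B / lam0) / lam0) * lam)"
    unfolding E_def mult_exp_exp by (simp add: algebra_simps)
  finally show ?thesis using E by (simp add: E_def mult_left_mono)
qed

lemma strip_eq_cbox: "strip e a = cbox (Complex (-a) (-e)) (Complex a e)"
  by (auto simp: strip_def in_cbox_complex_iff)

lemma of_real_in_strip: "e \<ge> 0 \<Longrightarrow> t \<in> {-a..a} \<Longrightarrow> complex_of_real t \<in> strip e a"
  by (simp add: strip_def)

text \<open>The end points of the interval are included, where the approach is from one side only.\<close>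

lemma interval_islimpt:
  fixes a b c :: real
  assumes "a < b" "c \<in> {a..b}" "d > 0"
  shows "complex_of_real c islimpt (of_real ` {t \<in> {a..b}. \<bar>t - c\<bar> < d})"
  unfolding islimpt_approachable
proof (intro allI impI)
  fix e :: real assume "e > 0"
  define s where "s = min (min (d/2) (e/2)) ((b - a)/2)"
  have s: "s > 0" "s < d" "s < e" "s \<le> (b - a)/2" using assms \<open>e > 0\<close> by (auto simp: s_def min_def)
  obtain t where t: "t \<in> {a..b}" "\<bar>t - c\<bar> = s"
  proof (cases "c + s \<le> b")
    case True
    then show thesis using that[of "c + s"] assms s by auto
  next
    case False
    then show thesis using that[of "c - s"] assms s by auto
  qed
  show "\<exists>x'\<in>of_real ` {t \<in> {a..b}. \<bar>t - c\<bar> < d}. x' \<noteq> complex_of_real c \<and> dist x' (of_real c) < e"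
    using t s by (intro bexI[of _ "of_real t"]) (auto simp: dist_of_real dist_real_def)
qed

theorem theorem1p1:
  fixes \<Omega> H :: "(real^2) set" and q :: "real \<Rightarrow> real^2"
  assumes "piecewise_analytic_domain \<Omega>"
    and "analytic_parametrization q H"
    and "H \<subseteq> \<Omega>"
  shows "\<exists>\<epsilon>max>0. \<forall>\<epsilon>0 qC. 0 < \<epsilon>0 \<and> \<epsilon>0 \<le> \<epsilon>max \<and> curve_extension \<epsilon>0 q qC \<longrightarrow>
    (\<forall>C>0. \<forall>lam0>0. \<exists>K>0. \<forall>bc (lam :: nat \<Rightarrow> real) (\<phi> :: nat \<Rightarrow> real^2 \<Rightarrow> real) F.
       (\<forall>j. normalized_eigenfunction bc \<Omega> (lam j) (\<phi> j)) \<longrightarrow>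
       (\<forall>j. holomorphic_continuation \<epsilon>0 q qC (\<phi> j) (F j)) \<longrightarrow>
       revised_goodness \<epsilon>0 qC lam F C lam0 \<longrightarrow>
       (\<forall>j. lam j \<ge> lam0 \<longrightarrow>
          finite (nodal_points (\<phi> j) H) \<and> real (card (nodal_points (\<phi> j) H)) \<le> K * lam j))"
proof (cases "\<exists>\<epsilon>1 qC1. \<epsilon>1 > 0 \<and> curve_extension \<epsilon>1 q qC1")
  case False
  \<comment> \<open>Without any holomorphic extension of the parametrization there is nothing to prove.\<close>
  then show ?thesis by (intro exI[of _ 1]) auto
next
  case True
  then obtain \<epsilon>1 g where \<epsilon>1: "\<epsilon>1 > 0" and "curve_extension \<epsilon>1 q g" by blast
  then have g: "\<And>i. (\<lambda>t. g t $ i) holomorphic_on strip (2 * \<epsilon>1) (2 * pi)"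
    and gq: "\<And>t i. t \<in> {-pi..pi} \<Longrightarrow> g (of_real t) $ i = of_real (q t $ i)"
    by (auto simp: curve_extension_def)
  have O: "open \<Omega>" "bounded \<Omega>" using assms(1) by (auto simp: piecewise_analytic_domain_def)
  have H: "q ` {-pi..pi} = H" using assms(2) by (simp add: analytic_parametrization_def)
  let ?S = "strip (2 * \<epsilon>1) (2 * pi)"
  have gc: "continuous_on ?S (\<lambda>t. g t $ i)" for i using g holomorphic_on_imp_continuous_on by blast
  have inS: "complex_of_real t \<in> ?S" if "t \<in> {-pi..pi}" for t
    using that \<epsilon>1 pi_gt_zero by (auto simp: strip_def)
  have "continuous_on {-pi..pi} (\<lambda>t. \<chi> i. q t $ i)"
  proof (rule continuous_on_vec_lambda)
    fix i
    have "continuous_on {-pi..pi} (\<lambda>t. Re (g (of_real t) $ i))"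
      by (intro continuous_intros continuous_on_compose2[OF gc]) (use inS in auto)
    then show "continuous_on {-pi..pi} (\<lambda>t. q t $ i)"
      by (rule continuous_on_eq) (simp add: gq)
  qed
  then have "continuous_on {-pi..pi} q" by simp
  then have "compact H" unfolding H[symmetric] by (intro compact_continuous_image) auto
  then obtain e where e: "e > 0" "(\<Union>x\<in>H. ball x e) \<subseteq> \<Omega>"
    using compact_subset_open_imp_ball_epsilon_subset[OF _ O(1) assms(3)] by metis
  define R where "R = e / 2"
  have R: "R > 0" using e by (simp add: R_def)
  have cb: "cball x R \<subseteq> \<Omega>" if "x \<in> H" for x
  proof -
    have "cball x R \<subseteq> ball x e" using e by (auto simp: R_def)
    then show ?thesis using e(2) that by blast
  qed
  \<comment> \<open>A single cutoff, translated to the points of the curve, serves for all of them, so the constants are uniform.\<close>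
  obtain A \<eta> \<eta>1 \<eta>2 where A: "A > 0" and cut: "cutoff R A \<eta> \<eta>1 \<eta>2" using cutoff_exists[OF R] by blast
  have "\<forall>i. \<exists>d>0. \<forall>s\<in>?S. \<forall>t\<in>?S. dist t s < d \<longrightarrow> dist (g t $ i) (g s $ i) < R / 16"
    using compact_uniformly_continuous[OF gc] R
    unfolding uniformly_continuous_on_def strip_eq_cbox by (metis compact_cbox divide_pos_pos zero_less_numeral)
  then obtain d where d: "\<And>i. d i > 0"
     "\<And>i s t. s \<in> ?S \<Longrightarrow> t \<in> ?S \<Longrightarrow> dist t s < d i \<Longrightarrow> dist (g t $ i) (g s $ i) < R / 16"
    by metis
  \<comment> \<open>Points of the strip closer than \<open>dm\<close> have images whose components differ by less than \<open>R / 16\<close>.\<close>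
  define dm where "dm = Min (range d)"
  have dm: "dm > 0" "\<And>i. dm \<le> d i" using d(1) by (auto simp: dm_def)
  define \<delta> where "\<delta> = min (dm / 4) 1"
  have \<delta>: "\<delta> > 0" "\<delta> \<le> dm / 4" "\<delta> \<le> 1" using dm by (auto simp: \<delta>_def)
  \<comment> \<open>Then points with \<open>\<bar>Re s - t0\<bar> < \<delta>\<close> and \<open>\<bar>Im s\<bar> < 2 * \<epsilon>m\<close> are within \<open>dm / 2\<close> of \<open>t0\<close>; \<open>\<delta> \<le> 1 < pi\<close> keeps the rectangle below inside the strip.\<close>
  define \<epsilon>m where "\<epsilon>m = min \<epsilon>1 (dm / 8)"
  have \<epsilon>m: "\<epsilon>m > 0" "\<epsilon>m \<le> \<epsilon>1" "2 * \<epsilon>m \<le> dm / 4" using dm \<epsilon>1 by (auto simp: \<epsilon>m_def)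
  show ?thesis
  proof (rule exI[of _ \<epsilon>m], intro conjI allI impI \<epsilon>m(1))
    fix \<epsilon>0 qC and C lam0 :: real
    assume "0 < \<epsilon>0 \<and> \<epsilon>0 \<le> \<epsilon>m \<and> curve_extension \<epsilon>0 q qC" and C: "C > 0" and lam0: "lam0 > 0"
    then have \<epsilon>0: "\<epsilon>0 > 0" "\<epsilon>0 \<le> \<epsilon>m" by auto
    \<comment> \<open>The tube parameters fill the compact rectangle \<open>?K\<close>, and the growth estimate holds on the slightly larger open rectangle \<open>?D\<close>.\<close>
    let ?D = "box (Complex (-pi - \<delta>) (-2 * \<epsilon>0)) (Complex (pi + \<delta>) (2 * \<epsilon>0))"
    let ?K = "strip \<epsilon>0 pi"
    have D: "open ?D" "simply_connected ?D" "?D \<noteq> UNIV"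
      using bounded_box[of "Complex (-pi - \<delta>) (-2 * \<epsilon>0)" "Complex (pi + \<delta>) (2 * \<epsilon>0)"]
      by (auto intro!: convex_imp_simply_connected open_box convex_box)
    have "complex_of_real 0 \<in> ?K" using \<epsilon>0 by (intro of_real_in_strip) auto
    then have K3: "?K \<noteq> {}" by blast
    have K: "compact ?K" "?K \<subseteq> ?D"
      using \<epsilon>0 \<delta> by (auto simp: strip_eq_cbox in_cbox_complex_iff in_box_complex_iff)
    obtain c where c: "c > 0"
      "\<And>A f M m z. \<lbrakk>finite A; A \<subseteq> ?K; f holomorphic_on ?D; \<And>w. w \<in> ?D \<Longrightarrow> norm (f w) \<le> M;
        \<And>a. a \<in> A \<Longrightarrow> f a = 0; z \<in> ?K; 0 < m; m \<le> norm (f z)\<rbrakk> \<Longrightarrow> real (card A) \<le> c * ln (M / m)"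
      using zero_count[OF D K(1,2)] by blast
    let ?B = "commutator_const R A"
    define V where "V = (measure lborel \<Omega> + 1) / 2 / gauss_mass"
    have V: "V > 0" using gauss_mass_pos by (simp add: V_def add_nonneg_pos)
    have B: "?B > 0" using commutator_const_pos R A by simp
    define C' where "C' = 2 + R\<^sup>2 / 4 + V * (A + ?B / lam0) / lam0"
    have C': "C' > 0" using V A B lam0 by (auto simp: C'_def add_pos_nonneg)
    show "\<exists>K>0. \<forall>bc (lam :: nat \<Rightarrow> real) (\<phi> :: nat \<Rightarrow> real^2 \<Rightarrow> real) F.
       (\<forall>j. normalized_eigenfunction bc \<Omega> (lam j) (\<phi> j)) \<longrightarrow>
       (\<forall>j. holomorphic_continuation \<epsilon>0 q qC (\<phi> j) (F j)) \<longrightarrow>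
       revised_goodness \<epsilon>0 qC lam F C lam0 \<longrightarrow>
       (\<forall>j. lam j \<ge> lam0 \<longrightarrow>
          finite (nodal_points (\<phi> j) H) \<and> real (card (nodal_points (\<phi> j) H)) \<le> K * lam j)"
    proof (rule exI[of _ "c * (C' + C)"], intro conjI allI impI)
      show "c * (C' + C) > 0" using c C C' by simp
      fix bc :: boundary_condition and lam and \<phi> :: "nat \<Rightarrow> real^2 \<Rightarrow> real" and F j
      assume "\<forall>j. normalized_eigenfunction bc \<Omega> (lam j) (\<phi> j)"
        and "\<forall>j. holomorphic_continuation \<epsilon>0 q qC (\<phi> j) (F j)"
        and good: "revised_goodness \<epsilon>0 qC lam F C lam0" and lj: "lam j \<ge> lam0"
      then have ef: "normalized_eigenfunction bc \<Omega> (lam j) (\<phi> j)"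
        and "holomorphic_continuation \<epsilon>0 q qC (\<phi> j) (F j)" by auto
      then obtain h where h: "h holomorphic_on strip (2 * \<epsilon>0) (2 * pi)"
          "\<And>t. t \<in> {-pi..pi} \<Longrightarrow> h (of_real t) = of_real (\<phi> j (q t))"
          "\<And>t. t \<in> ?K \<Longrightarrow> F j (qC t) = h t"
        unfolding holomorphic_continuation_def by blast
      have pi1: "pi > 1" using pi_gt3 by simp
      have Ds: "?D \<subseteq> strip (2 * \<epsilon>0) (2 * pi)"
        using \<delta> pi1 by (auto simp: strip_def in_box_complex_iff)
      have hD: "h holomorphic_on ?D" using h(1) Ds by (rule holomorphic_on_subset)
      have lam: "lam j > 0" using lj lam0 by simp
      have bound: "norm (h \<tau>) \<le> exp (C' * lam j)" if \<tau>: "\<tau> \<in> ?D" for \<tau>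
      proof -
        \<comment> \<open>The real parameter nearest to \<open>\<tau>\<close>: an end point of the interval if \<open>\<tau>\<close> lies beyond it.\<close>
        define t0 where "t0 = max (-pi) (min pi (Re \<tau>))"
        have t0: "t0 \<in> {-pi..pi}" "\<bar>Re \<tau> - t0\<bar> < \<delta>"
          using \<tau> \<delta> pi1 by (auto simp: t0_def in_box_complex_iff max_def min_def)
        define x0 where "x0 = q t0"
        have x0: "x0 \<in> H" using H t0 by (auto simp: x0_def)
        let ?U = "box (Complex (t0 - \<delta>) (-2 * \<epsilon>0)) (Complex (t0 + \<delta>) (2 * \<epsilon>0))"
        have US: "?U \<subseteq> ?S" using \<delta> \<epsilon>0 \<epsilon>m pi1 t0 by (auto simp: strip_def in_box_complex_iff)
        have UD: "?U \<subseteq> ?D" using \<delta> t0 by (auto simp: in_box_complex_iff)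
        interpret E: localized_eigenfunction \<Omega> "\<phi> j" x0 R A "lam j" \<eta> \<eta>1 \<eta>2
          using R A O(1) cb[OF x0] ef cut
          by unfold_locales (auto simp: normalized_eigenfunction_def)
        have close: "norm (g s $ i - of_real (x0 $ i)) < R / 16" if "s \<in> ?U" for s i
        proof -
          have "norm (s - of_real t0) \<le> \<bar>Re (s - of_real t0)\<bar> + \<bar>Im (s - of_real t0)\<bar>" by (rule cmod_le)
          also have "\<dots> < dm" using that \<delta> \<epsilon>0 \<epsilon>m dm(1) by (auto simp: in_box_complex_iff)
          finally have "dist s (of_real t0) < d i" using dm(2)[of i] by (simp add: dist_norm)
          then have "dist (g s $ i) (g (of_real t0) $ i) < R / 16"
            using that US inS[OF t0(1)] by (intro d(2)) auto
          then show ?thesis using gq[OF t0(1)] by (simp add: dist_norm x0_def)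
        qed
        have nr: "near x0 R (g s)" if "s \<in> ?U" for s
          unfolding near_def
        proof (intro allI conjI)
          fix i
          have "\<bar>Re (g s $ i - of_real (x0 $ i))\<bar> \<le> norm (g s $ i - of_real (x0 $ i))"
            "\<bar>Im (g s $ i - of_real (x0 $ i))\<bar> \<le> norm (g s $ i - of_real (x0 $ i))"
            by (rule abs_Re_le_cmod, rule abs_Im_le_cmod)
          then show "\<bar>Re (g s $ i) - x0 $ i\<bar> \<le> R / 8" "\<bar>Im (g s $ i)\<bar> \<le> R / 16"
            using close[OF that, of i] R by auto
        qed
        let ?T = "complex_of_real ` {t \<in> {-pi..pi}. \<bar>t - t0\<bar> < \<delta>}"
        have TU: "?T \<subseteq> ?U" using \<epsilon>0 by (auto simp: in_box_complex_iff)
        have "norm (h \<tau>) \<le> exp (lam j) * (A * lam j * exp (R\<^sup>2 * lam j / 4) + ?B / lam j) * E.phi_mass / gauss_mass"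
        proof (rule E.holomorphic_extension_bound[where h = h and \<tau> = \<tau> and g = g and \<xi> = "of_real t0", OF lam open_box convex_box(2) _ nr _ TU])
          show "(\<lambda>\<tau>. g \<tau> $ i) holomorphic_on ?U" for i using g US by (rule holomorphic_on_subset)
          show "h holomorphic_on ?U" using hD UD by (rule holomorphic_on_subset)
          show "of_real t0 \<in> ?U" using \<delta> \<epsilon>0 by (simp add: in_box_complex_iff)
          show "complex_of_real t0 islimpt ?T" using interval_islimpt t0(1) \<delta>(1) pi1 by simp
          show "\<tau> \<in> ?U" using \<tau> t0 by (auto simp: in_box_complex_iff)
          fix s assume s: "s \<in> ?T"
          then obtain t where t: "s = of_real t" "t \<in> {-pi..pi}" by auto
          have qg: "g s = complex_vec (q t)" using gq[OF t(2)] t(1) by (simp add: complex_vec_def vec_eq_iff)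
          have "norm (q t - x0) \<le> (\<Sum>i\<in>UNIV. \<bar>(q t - x0) $ i\<bar>)" by (rule norm_le_l1_cart)
          also have "\<dots> \<le> (\<Sum>i\<in>(UNIV::2 set). R / 16)"
          proof (rule sum_mono)
            fix i
            have "norm (complex_of_real (q t $ i - x0 $ i)) < R / 16"
              using close[of s i] TU s gq[OF t(2), of i] t(1) by auto
            then show "\<bar>(q t - x0) $ i\<bar> \<le> R / 16" unfolding norm_of_real by simp
          qed
          also have "\<dots> \<le> R / 2" using R by simp
          finally show "\<exists>x. g s = complex_vec x \<and> norm (x - x0) \<le> R / 2 \<and> h s = of_real (\<phi> j x)"
            using qg h(2)[OF t(2)] t(1) by auto
        qed
        also have "\<dots> = exp (lam j) * (A * lam j * exp (R\<^sup>2 * lam j / 4) + ?B / lam j) * (E.phi_mass / gauss_mass)" by simp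
        also have "\<dots> \<le> exp (lam j) * (A * lam j * exp (R\<^sup>2 * lam j / 4) + ?B / lam j) * V"
        proof (intro mult_left_mono)
          show "E.phi_mass / gauss_mass \<le> V" unfolding V_def
            using gauss_mass_pos E.phi_mass_le[OF O(2)] ef
            by (intro divide_right_mono) (auto simp: normalized_eigenfunction_def)
        qed (use A B lam in auto)
        also have "\<dots> \<le> exp (C' * lam j)"
          unfolding C'_def by (rule growth_constant_le_exp) (use lam0 lj A B V in auto)
        finally show ?thesis .
      qed
      \<comment> \<open>The goodness condition provides a point of the tube where the extension is not too small.\<close>
      have "continuous_on ?K h"
        using hD K(2) by (meson continuous_on_subset holomorphic_on_imp_continuous_on)
      then have "continuous_on ?K (\<lambda>t. norm (h t))" by (rule continuous_on_norm)
      then obtain z where z: "z \<in> ?K" "\<And>t. t \<in> ?K \<Longrightarrow> norm (h t) \<le> norm (h z)"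
        using continuous_attains_sup[OF K(1) K3] by blast
      have "exp (- (C * lam j)) \<le> (SUP z\<in>grauert_tube \<epsilon>0 qC. norm (F j z))"
        using good lj by (simp add: revised_goodness_def)
      also have "\<dots> \<le> norm (h z)"
        unfolding grauert_tube_def using K3 z(2) h(3) by (intro cSUP_least) auto
      finally have hz: "exp (- (C * lam j)) \<le> norm (h z)" .
      \<comment> \<open>Distinct nodal points come from distinct parameters, so it suffices to count parameters; finiteness follows from a uniform bound on all finite subsets.\<close>
      define Z where "Z = {t \<in> {-pi..pi}. \<phi> j (q t) = 0}"
      have card: "card G \<le> nat \<lfloor>c * (C' + C) * lam j\<rfloor>" if "G \<subseteq> Z" "finite G" for G
      proof -
        have "real (card (complex_of_real ` G)) \<le> c * ln (exp (C' * lam j) / exp (- (C * lam j)))"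
        proof (rule c(2)[OF _ _ hD bound _ z(1) _ hz])
          show "complex_of_real ` G \<subseteq> ?K" using that \<epsilon>0 by (auto simp: Z_def strip_def)
          show "h a = 0" if "a \<in> complex_of_real ` G" for a
            using that \<open>G \<subseteq> Z\<close> h(2) by (auto simp: Z_def)
        qed (use that in auto)
        also have "exp (C' * lam j) / exp (- (C * lam j)) = exp ((C' + C) * lam j)"
          by (simp add: exp_diff[symmetric] algebra_simps)
        finally have "real (card (complex_of_real ` G)) \<le> c * (C' + C) * lam j" by simp
        moreover have "card (complex_of_real ` G) = card G"
          by (intro card_image) (auto simp: inj_on_def)
        ultimately show ?thesis by (simp add: le_nat_floor)
      qed
      have Z: "finite Z" "card Z \<le> nat \<lfloor>c * (C' + C) * lam j\<rfloor>"
        using finite_if_finite_subsets_card_bdd[of Z] card by blast+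
      have nod: "nodal_points (\<phi> j) H = q ` Z" by (auto simp: nodal_points_def Z_def H[symmetric])
      show "finite (nodal_points (\<phi> j) H)" using Z by (simp add: nod)
      have "0 \<le> c * (C' + C) * lam j" using c C C' lam by simp
      then have "real (card Z) \<le> c * (C' + C) * lam j"
        using Z(2) by (meson of_nat_floor of_nat_le_iff order_trans)
      then show "real (card (nodal_points (\<phi> j) H)) \<le> c * (C' + C) * lam j"
        using card_image_le[OF Z(1), of q] by (simp add: nod)
    qed
  qed
qed

end
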